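(* For every $i\ge 1$, the sequence of operators $(Y_i^{(k)})_{k\ge i}$ has a limit operator on $\mathcal P_{as}^+$, and this limit equals $\mathscr Y_i$: $$\mathscr Y_i=\lim_k Y_i^{(k)} .$$
   Context: Let $\mathbb K=\mathbb Q(t,q)$. For $k\ge1$ let $\mathcal P_k^+=\mathbb K[x_1,\dots,x_k]$, and let $\pi_k:\mathcal P_k^+\to\mathcal P_{k-1}^+$ be evaluation at $x_k=0$. Let $\mathcal P_\infty^+$ be the graded inverse limit of the $\mathcal P_k^+$ (formal polynomials: bounded-degree formal series in $x_1,x_2,\dots$), with canonical maps $\Pi_k:\mathcal P_\infty^+\to\mathcal P_k^+$. The simple transpositions $s_i$ (swapping $x_i$ and $x_{i+1}$) act on $\mathcal P_\infty^+$. Put $\mathcal P(k)^+=\{F\in\mathcal P_\infty^+ : s_iF=F \text{ for all } i>k\}$ and $\mathcal P_{as}^+=\bigcup_{k\ge0}\mathcal P(k)^+$. Limits. For $R=A/B\in\mathbb K$ with $A,B\in\mathbb Q[t,q]$, $\operatorname{ord}R$ is the order of vanishing of $A$ at $t=0$ minus that of $B$. A sequence $(a_n)$ in $\mathbb K$ converges to $a$ if $\operatorname{ord}(a_n-a)\to+\infty$. A sequence $(f_k)$, $f_k\in\mathcal P_k^+$ (the starting index is irrelevant), is convergent if there are $N\ge 1$ and sequences $h_k,g_{i,k}\in\mathcal P_k^+$, $a_{i,k}\in\mathbb K$ ($1\le i\le N$) with $f_k=h_k+\sum_{i=1}^Na_{i,k}g_{i,k}$ for all $k$, $\pi_k(h_k)=h_{k-1}$,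 $\pi_k(g_{i,k})=g_{i,k-1}$, such that the element $g_i\in\mathcal P_\infty^+$ defined by $(g_{i,k})_k$ lies in $\mathcal P_{as}^+$ and $(a_{i,k})_k$ converges to some $a_i\in\mathbb K$. Then $\lim_kf_k:=h+\sum_i a_ig_i\in\mathcal P_\infty^+$, with $h$ the element of $\mathcal P_\infty^+$ defined by $(h_k)$; this is independent of choices. A sequence of operators $A_k:\mathcal P_k^+\to\mathcal P_k^+$ has a limit operator $A=\lim_kA_k:\mathcal P_{as}^+\to\mathcal P_{as}^+$ if for every $f\in\mathcal P_{as}^+$ the sequence $(A_k\Pi_kf)_k$ converges to an element of $\mathcal P_{as}^+$, and then $Af:=\lim_kA_k\Pi_kf$. Operators. On $\mathcal P_k^+$ let $T_if=s_if+(1-t)x_i\frac{f-s_if}{x_i-x_{i+1}}$ for $1\le i\le k-1$, $\ \omega_k^{-1}f(x_1,\dots,x_k)=f(x_2,\dots,x_k,qx_1)$, and $$Y_i^{(k)}=t^{k+1-i}T_{i-1}\cdots T_1\,\omega_k^{-1}\,T_{k-1}^{-1}\cdots T_i^{-1},\qquad 1\le i\le k$$ (the Cherednik operators). Let $\mathrm{pr}_1$ be the $\mathbb K$-linear map on $\mathcal P_k^+$ that is the identity on monomials divisible by $x_1$ and zero on monomials not divisible by $x_1$, let $\varpi_k=\mathrm{pr}_1\omega_k^{-1}$, and let $$\widetilde Y_i^{(k)}=t^{k+1-i}T_{i-1}\cdots T_1\,\varpi_k\,T_{k-1}^{-1}\cdots T_i^{-1}$$ (the deformed Cherednik operators). It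 is known that $(\widetilde Y_i^{(k)})_{k\ge i}$ has a limit operator, and by definition $\mathscr Y_i:=\lim_k\widetilde Y_i^{(k)}:\mathcal P_{as}^+\to\mathcal P_{as}^+$. *)

theory Defs
  imports
    Complex_Main
    "HOL-Library.Poly_Mapping"
    "HOL-Library.Extended_Real"
    "HOL-Computational_Algebra.Polynomial"
    "HOL-Computational_Algebra.Fraction_Field"
    "HOL-Combinatorics.Transposition"
begin

section \<open>The field of coefficients\<close>

text \<open>
  The field of rational functions in t and q is the fraction field of (Q[q])[t]: the outer
  polynomial variable is t, the inner one is q.
\<close>

type_synonym coef = "rat poly poly fract"

definition t_var :: coef where
  "t_var = Fract [:0, 1:] 1"

definition q_var :: coef where
  "q_var = Fract [:[:0, 1:]:] 1"

text \<open>Order of vanishing at t = 0, with the value infinity at the zero function.\<close>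

definition ord_t :: "coef \<Rightarrow> ereal" where
  "ord_t R = (if R = 0 then \<infinity> else
     ereal (of_int (THE n. \<exists>A B. A \<noteq> 0 \<and> B \<noteq> 0 \<and> R = Fract A B \<and>
                             n = int (order 0 A) - int (order 0 B))))"

lemma ord_t_Fract:
  assumes "A \<noteq> 0" "B \<noteq> 0"
  shows "ord_t (Fract A B) = ereal (of_int (int (order 0 A) - int (order 0 B)))"
proof -
  have "n = int (order 0 A) - int (order 0 B)"
    if "C \<noteq> 0" "D \<noteq> 0" "Fract A B = Fract C D" "n = int (order 0 C) - int (order 0 D)" for C D n
  proof -
    have "A * D = C * B"
      using that assms by (simp add: eq_fract)
    then have "order 0 A + order 0 D = order 0 C + order 0 B"
      using that assms by (metis mult_eq_0_iff order_mult)
    then show ?thesis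
      using that by linarith
  qed
  then have "(THE n. \<exists>C D. C \<noteq> 0 \<and> D \<noteq> 0 \<and> Fract A B = Fract C D \<and>
               n = int (order 0 C) - int (order 0 D)) = int (order 0 A) - int (order 0 B)"
    using assms by (intro the_equality) blast+
  moreover have "Fract A B \<noteq> 0"
    using assms by (simp add: Zero_fract_def eq_fract)
  ultimately show ?thesis
    by (simp add: ord_t_def)
qed

definition coef_converges :: "(nat \<Rightarrow> coef) \<Rightarrow> coef \<Rightarrow> bool" where
  "coef_converges a l \<longleftrightarrow> (\<lambda>n. ord_t (a n - l)) \<longlonglongrightarrow> \<infinity>"


section \<open>Polynomials and formal polynomials\<close>

text \<open>
  A monomial is a finitely supported exponent function. Variables are numbered from 1 on, and the
  polynomials in k variables are those involving only the variables with numbers 1 to k.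
\<close>

type_synonym mon = "nat \<Rightarrow>\<^sub>0 nat"
type_synonym mpol = "mon \<Rightarrow>\<^sub>0 coef"

definition Const :: "coef \<Rightarrow> mpol" where
  "Const c = Poly_Mapping.single 0 c"

definition X :: "nat \<Rightarrow> mpol" where
  "X j = Poly_Mapping.single (Poly_Mapping.single j 1) 1"

definition subst :: "(nat \<Rightarrow> mpol) \<Rightarrow> mpol \<Rightarrow> mpol" where
  "subst \<sigma> p = (\<Sum>m\<in>Poly_Mapping.keys p. Const (Poly_Mapping.lookup p m) *
                  (\<Prod>j\<in>Poly_Mapping.keys m. \<sigma> j ^ Poly_Mapping.lookup m j))"

definition mon_degree :: "mon \<Rightarrow> nat" where
  "mon_degree m = (\<Sum>j\<in>Poly_Mapping.keys m. Poly_Mapping.lookup m j)"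

definition Pk :: "nat \<Rightarrow> mpol set" where
  "Pk k = {p. \<forall>m\<in>Poly_Mapping.keys p. Poly_Mapping.keys m \<subseteq> {1..k}}"

definition proj :: "nat \<Rightarrow> mpol \<Rightarrow> mpol" where
  "proj k = subst (\<lambda>j. if j = k then 0 else X j)"

text \<open>
  An element of the graded inverse limit is the compatible family of its images in the rings of
  polynomials in k variables, of bounded degree. So the canonical map to polynomials in k variables
  is evaluation of the family at k.
\<close>

type_synonym fpol = "nat \<Rightarrow> mpol"

definition Pinf :: "fpol set" where
  "Pinf = {F. (\<forall>k. F k \<in> Pk k) \<and> (\<forall>k\<ge>1. proj k (F k) = F (k - 1)) \<and>
              (\<exists>d. \<forall>k. \<forall>m\<in>Poly_Mapping.keys (F k). mon_degree m \<le> d)}"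

definition swap :: "nat \<Rightarrow> mpol \<Rightarrow> mpol" where
  "swap i = subst (\<lambda>j. X (Transposition.transpose i (Suc i) j))"

definition trunc :: "nat \<Rightarrow> mpol \<Rightarrow> mpol" where
  "trunc k = subst (\<lambda>j. if j \<le> k then X j else 0)"

text \<open>
  The transposition of the variables i and i + 1 does not act on polynomials in fewer than i + 1
  variables; there the component of the result is the truncation of a later one.
\<close>

definition swap_inf :: "nat \<Rightarrow> fpol \<Rightarrow> fpol" where
  "swap_inf i F = (\<lambda>k. trunc k (swap i (F (max k (Suc i)))))"

definition Psym :: "nat \<Rightarrow> fpol set" where
  "Psym k = {F \<in> Pinf. \<forall>i>k. swap_inf i F = F}"

definition Pas :: "fpol set" where
  "Pas = (\<Union>k. Psym k)"


section \<open>Limits of sequences and of operators\<close>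

text \<open>
  The sequences start at the index k0. Compatible sequences starting at k0 that define an element of
  the inverse limit are the same thing as elements of the inverse limit. The limit does not depend on
  the decomposition: at each monomial its coefficient is the limit of the coefficients of the sequence.
\<close>

definition has_lim :: "nat \<Rightarrow> (nat \<Rightarrow> mpol) \<Rightarrow> fpol \<Rightarrow> bool" where
  "has_lim k0 f F \<longleftrightarrow>
     (\<exists>N::nat. \<exists>h g a l. N \<ge> 1 \<and> h \<in> Pinf \<and>
        (\<forall>i\<in>{1..N}. g i \<in> Pas \<and> coef_converges (a i) (l i)) \<and>
        (\<forall>k\<ge>k0. f k = h k + (\<Sum>i=1..N. Const (a i k) * g i k)) \<and>
        F = (\<lambda>k. h k + (\<Sum>i=1..N. Const (l i) * g i k)))"

definition the_lim :: "nat \<Rightarrow> (nat \<Rightarrow> mpol) \<Rightarrow> fpol" where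
  "the_lim k0 f = (THE F. has_lim k0 f F)"

definition has_limit_operator :: "nat \<Rightarrow> (nat \<Rightarrow> mpol \<Rightarrow> mpol) \<Rightarrow> bool" where
  "has_limit_operator k0 A \<longleftrightarrow> (\<forall>f\<in>Pas. \<exists>F\<in>Pas. has_lim k0 (\<lambda>k. A k (f k)) F)"

definition limit_operator :: "nat \<Rightarrow> (nat \<Rightarrow> mpol \<Rightarrow> mpol) \<Rightarrow> fpol \<Rightarrow> fpol" where
  "limit_operator k0 A f = the_lim k0 (\<lambda>k. A k (f k))"


section \<open>Cherednik operators and deformed Cherednik operators\<close>

text \<open>
  The quotient in the following exists, as the numerator is antisymmetric under the swap, and it is
  unique, as the polynomial ring is an integral domain.
\<close>

definition T :: "nat \<Rightarrow> mpol \<Rightarrow> mpol" where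
  "T i f = swap i f + Const (1 - t_var) * X i * (THE g. g * (X i - X (Suc i)) = f - swap i f)"

definition T_inv :: "nat \<Rightarrow> nat \<Rightarrow> mpol \<Rightarrow> mpol" where
  "T_inv k i = inv_into (Pk k) (T i)"

definition omega_inv :: "nat \<Rightarrow> mpol \<Rightarrow> mpol" where
  "omega_inv k = subst (\<lambda>j. if j < k then X (Suc j) else if j = k then Const q_var * X 1 else X j)"

definition pr1 :: "mpol \<Rightarrow> mpol" where
  "pr1 p = (\<Sum>m\<in>{m \<in> Poly_Mapping.keys p. 1 \<in> Poly_Mapping.keys m}.
              Poly_Mapping.single m (Poly_Mapping.lookup p m))"

definition varpi :: "nat \<Rightarrow> mpol \<Rightarrow> mpol" where
  "varpi k f = pr1 (omega_inv k f)"

text \<open>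
  In the following, fold applies the operators of the list from left to right, the head first.
\<close>

definition cherednik :: "nat \<Rightarrow> nat \<Rightarrow> mpol \<Rightarrow> mpol" where
  "cherednik i k f =
     Const (t_var ^ (k + 1 - i)) * fold T [1..<i] (omega_inv k (fold (T_inv k) [i..<k] f))"

definition deformed_cherednik :: "nat \<Rightarrow> nat \<Rightarrow> mpol \<Rightarrow> mpol" where
  "deformed_cherednik i k f =
     Const (t_var ^ (k + 1 - i)) * fold T [1..<i] (varpi k (fold (T_inv k) [i..<k] f))"

definition limit_cherednik :: "nat \<Rightarrow> fpol \<Rightarrow> fpol" where
  "limit_cherednik i = limit_operator i (deformed_cherednik i)"

end

theory Submission
  imports Defs
begin

text \<open>
  Let \<open>U\<^sub>i = t T\<^sub>i\<^sup>-\<^sup>1\<close>, which needs no division by t: it sends f to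
  \<open>t s\<^sub>i f + (1 - t) x\<^sub>i\<^sub>+\<^sub>1 \<partial>\<^sub>i f\<close>, where \<open>\<partial>\<^sub>i\<close> is the divided difference. The powers of t in the
  Cherednik operator are just those that turn every inverse into a \<open>U\<close>, up to one factor t, so
  the question is about the behaviour of \<open>A\<^sub>k = \<omega>\<^sub>k\<^sup>-\<^sup>1 U\<^sub>k\<^sub>-\<^sub>1 \<cdots> U\<^sub>i F\<^sub>k\<close> for an almost symmetric
  F. The remaining operators \<open>T\<^sub>i\<^sub>-\<^sub>1 \<cdots> T\<^sub>1\<close> do not depend on k, and they preserve almost
  symmetric families.

  Two evaluations of \<open>U\<^sub>j\<close> decide everything. If a ring homomorphism \<open>\<phi>\<close> kills \<open>x\<^sub>j\<^sub>+\<^sub>1\<close>, then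
  \<open>\<phi> (U\<^sub>j G) = t \<phi> (s\<^sub>j G)\<close>. If it kills \<open>x\<^sub>j\<close> but not \<open>x\<^sub>j\<^sub>+\<^sub>1\<close>, then
  \<open>\<phi> (U\<^sub>j G) = \<phi> (s\<^sub>j G) - (1 - t) \<phi> G\<close>. Iterating the first, a zero put in place of the last
  variable moves through \<open>U\<^sub>k\<^sub>-\<^sub>1 \<cdots> U\<^sub>i\<close> to the variable number i, at the cost of a factor t at
  each step (lemma \<open>subst_fold_U_zero\<close>). There are two consequences.

  \<^item> Setting the last variable to zero gives \<open>\<pi>\<^sub>k\<^sub>+\<^sub>1 A\<^sub>k\<^sub>+\<^sub>1 = A\<^sub>k - (1 - t) t\<^sup>k\<^sup>-\<^sup>i C\<^sub>k\<close> with
    \<open>C\<^sub>k = F\<^sub>k\<^sub>+\<^sub>1 (x\<^sub>2, \<dots>, x\<^sub>i, 0, x\<^sub>i\<^sub>+\<^sub>1, \<dots>, x\<^sub>k, q x\<^sub>1)\<close> (lemma \<open>proj_omega_inv_fold_U\<close>). As F is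
    almost symmetric, the \<open>C\<^sub>k\<close> are compatible for large k, and then so are the polynomials
    \<open>H\<^sub>k = A\<^sub>k - t\<^sup>k\<^sup>-\<^sup>i C\<^sub>k\<close>. Hence \<open>A\<^sub>k = H\<^sub>k + t\<^sup>k\<^sup>-\<^sup>i C\<^sub>k\<close> converges to H.
  \<^item> Setting \<open>x\<^sub>1\<close> to zero gives \<open>A\<^sub>k - pr\<^sub>1 A\<^sub>k = t\<^sup>k\<^sup>-\<^sup>i B\<^sub>k\<close> with
    \<open>B\<^sub>k = F\<^sub>k (x\<^sub>2, \<dots>, x\<^sub>i, 0, x\<^sub>i\<^sub>+\<^sub>1, \<dots>, x\<^sub>k)\<close> (lemma \<open>pr1_omega_inv_fold_U\<close>), again a compatible
    family. So the Cherednik operators and the deformed ones differ by a sequence that converges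
    to zero, and they have the same limits.

  That H is almost symmetric comes from \<open>s\<^sub>j U\<^sub>j\<^sub>+\<^sub>1 U\<^sub>j f = U\<^sub>j\<^sub>+\<^sub>1 U\<^sub>j f\<close> for f symmetric in
  \<open>x\<^sub>j\<^sub>+\<^sub>1\<close> and \<open>x\<^sub>j\<^sub>+\<^sub>2\<close> (lemma \<open>swap_U_U\<close>). The families H, C and B are compatible and symmetric
  only from some index on. Such a family extends to an almost symmetric formal polynomial, and a
  change of finitely many terms of a sequence can be absorbed into its decomposition, because every
  single polynomial is a component of an almost symmetric formal polynomial.
\<close>

section \<open>Substitution as a ring homomorphism\<close>

definition mon_eval :: "(nat \<Rightarrow> mpol) \<Rightarrow> mon \<Rightarrow> mpol" where
  "mon_eval \<sigma> m = (\<Prod>j\<in>Poly_Mapping.keys m. \<sigma> j ^ Poly_Mapping.lookup m j)"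

lemma subst_eq_sum:
  assumes "finite S" "Poly_Mapping.keys p \<subseteq> S"
  shows "subst \<sigma> p = (\<Sum>m\<in>S. Const (Poly_Mapping.lookup p m) * mon_eval \<sigma> m)"
  unfolding subst_def mon_eval_def
  by (rule sum.mono_neutral_left) (use assms in \<open>auto simp: in_keys_iff Const_def\<close>)

lemma mon_eval_superset:
  assumes "finite S" "Poly_Mapping.keys m \<subseteq> S"
  shows "mon_eval \<sigma> m = (\<Prod>j\<in>S. \<sigma> j ^ Poly_Mapping.lookup m j)"
  unfolding mon_eval_def
  by (rule prod.mono_neutral_left) (use assms in \<open>auto simp: in_keys_iff\<close>)

lemma mon_eval_add: "mon_eval \<sigma> (m + n) = mon_eval \<sigma> m * mon_eval \<sigma> n"
proof -
  let ?S = "Poly_Mapping.keys m \<union> Poly_Mapping.keys n"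
  have "mon_eval \<sigma> (m + n) = (\<Prod>j\<in>?S. \<sigma> j ^ Poly_Mapping.lookup (m + n) j)"
    by (rule mon_eval_superset) (use Poly_Mapping.keys_add[of m n] in auto)
  also have "\<dots> = (\<Prod>j\<in>?S. \<sigma> j ^ Poly_Mapping.lookup m j) * (\<Prod>j\<in>?S. \<sigma> j ^ Poly_Mapping.lookup n j)"
    by (simp add: lookup_add power_add prod.distrib)
  also have "\<dots> = mon_eval \<sigma> m * mon_eval \<sigma> n"
    by (simp add: mon_eval_superset[of ?S])
  finally show ?thesis .
qed

lemma Const_0 [simp]: "Const 0 = 0"
  and Const_1 [simp]: "Const 1 = 1"
  and Const_add: "Const (a + b) = Const a + Const b"
  and Const_diff: "Const (a - b) = Const a - Const b"
  and Const_minus: "Const (- a) = - Const a"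
  and Const_mult: "Const (a * b) = Const a * Const b"
  by (simp_all add: Const_def single_add single_diff single_uminus mult_single)

lemma Const_eq_0_iff [simp]: "Const a = 0 \<longleftrightarrow> a = 0"
  by (metis Const_def lookup_single_eq single_zero)

lemma subst_add: "subst \<sigma> (p + q) = subst \<sigma> p + subst \<sigma> q"
proof -
  let ?S = "Poly_Mapping.keys p \<union> Poly_Mapping.keys q"
  have "subst \<sigma> (p + q) = (\<Sum>m\<in>?S. Const (Poly_Mapping.lookup (p + q) m) * mon_eval \<sigma> m)"
    by (rule subst_eq_sum) (use Poly_Mapping.keys_add[of p q] in auto)
  then show ?thesis
    by (simp add: subst_eq_sum[of ?S] lookup_add Const_add distrib_right sum.distrib)
qed

lemma subst_single: "subst \<sigma> (Poly_Mapping.single m c) = Const c * mon_eval \<sigma> m"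
  by (subst subst_eq_sum[of "{m}"]) auto

lemma subst_0 [simp]: "subst \<sigma> 0 = 0"
  by (simp add: subst_def)

lemma subst_Const [simp]: "subst \<sigma> (Const c) = Const c"
  using subst_single[of \<sigma> 0 c] by (simp add: Const_def mon_eval_def)

lemma subst_1 [simp]: "subst \<sigma> 1 = 1"
  using subst_Const[of \<sigma> 1] by simp

lemma subst_X [simp]: "subst \<sigma> (X j) = \<sigma> j"
  by (simp add: X_def subst_single mon_eval_def)

lemma subst_sum: "subst \<sigma> (sum f A) = (\<Sum>x\<in>A. subst \<sigma> (f x))"
  by (induction A rule: infinite_finite_induct) (simp_all add: subst_add)

lemma sum_singles:
  "p = (\<Sum>m\<in>Poly_Mapping.keys p. Poly_Mapping.single m (Poly_Mapping.lookup p m))"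
  by (rule poly_mapping_eqI)
     (auto simp: lookup_sum lookup_single when_def sum.delta in_keys_iff)

lemma subst_mult: "subst \<sigma> (p * q) = subst \<sigma> p * subst \<sigma> q"
proof -
  let ?s = "\<lambda>p m. Poly_Mapping.single m (Poly_Mapping.lookup p m) :: mpol"
  have "subst \<sigma> (p * q) =
      subst \<sigma> ((\<Sum>m\<in>Poly_Mapping.keys p. ?s p m) * (\<Sum>n\<in>Poly_Mapping.keys q. ?s q n))"
    by (simp flip: sum_singles)
  also have "\<dots> = (\<Sum>m\<in>Poly_Mapping.keys p. \<Sum>n\<in>Poly_Mapping.keys q.
                     subst \<sigma> (?s p m) * subst \<sigma> (?s q n))"
    by (simp add: sum_product subst_sum mult_single subst_single mon_eval_add Const_mult mult_ac)
  also have "\<dots> = subst \<sigma> (\<Sum>m\<in>Poly_Mapping.keys p. ?s p m) * subst \<sigma> (\<Sum>n\<in>Poly_Mapping.keys q. ?s q n)"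
    by (simp add: sum_product subst_sum)
  also have "\<dots> = subst \<sigma> p * subst \<sigma> q"
    by (simp flip: sum_singles)
  finally show ?thesis .
qed

lemma subst_minus: "subst \<sigma> (- p) = - subst \<sigma> p"
  using subst_add[of \<sigma> p "- p"] by (simp add: eq_neg_iff_add_eq_0 add.commute)

lemma subst_diff: "subst \<sigma> (p - q) = subst \<sigma> p - subst \<sigma> q"
  using subst_add[of \<sigma> p "- q"] by (simp add: subst_minus)

lemmas subst_hom = subst_add subst_diff subst_mult subst_minus

lemma X_power: "X j ^ n = Poly_Mapping.single (Poly_Mapping.single j n) 1"
  by (induction n) (simp_all add: X_def mult_single flip: single_add)

lemma mon_eval_X: "mon_eval X m = Poly_Mapping.single m 1"
proof -
  have prod_single: "(\<Prod>j\<in>A. Poly_Mapping.single (g j) 1) = (Poly_Mapping.single (sum g A) 1 :: mpol)"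
    for g :: "nat \<Rightarrow> mon" and A
    by (induction A rule: infinite_finite_induct) (simp_all add: mult_single)
  have "(\<Sum>j\<in>Poly_Mapping.keys m. Poly_Mapping.single j (Poly_Mapping.lookup m j)) = m"
    by (rule poly_mapping_eqI)
       (auto simp: lookup_sum lookup_single when_def sum.delta in_keys_iff)
  then show ?thesis
    by (simp add: mon_eval_def X_power prod_single)
qed

lemma single_eq_mon_eval: "Poly_Mapping.single m c = Const c * mon_eval X m"
  by (simp add: mon_eval_X Const_def mult_single)

lemma subst_id: "subst X p = p"
  by (subst sum_singles[of p], subst subst_eq_sum[OF finite_keys subset_refl])
     (simp add: single_eq_mon_eval)

text \<open>
  A polynomial lies in the subring generated by the constants and the variables that occur in it,
  so an identity between two ring homomorphisms need only be checked on those variables.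
\<close>

lemma mpol_induct [case_names Const X add mult]:
  assumes "\<And>c. P (Const c)"
    and "\<And>m j. m \<in> Poly_Mapping.keys p \<Longrightarrow> j \<in> Poly_Mapping.keys m \<Longrightarrow> P (X j)"
    and add: "\<And>p q. P p \<Longrightarrow> P q \<Longrightarrow> P (p + q)"
    and mult: "\<And>p q. P p \<Longrightarrow> P q \<Longrightarrow> P (p * q)"
  shows "P p"
proof -
  have P0: "P 0" and P1: "P 1"
    using assms(1)[of 0] assms(1)[of 1] by simp_all
  have Psum: "P (sum f A)" if "\<And>x. x \<in> A \<Longrightarrow> P (f x)" for f and A :: "mon set"
    using that by (induction A rule: infinite_finite_induct) (auto intro: P0 add)
  have Pprod: "P (prod f A)" if "\<And>x. x \<in> A \<Longrightarrow> P (f x)" for f and A :: "nat set"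
    using that by (induction A rule: infinite_finite_induct) (auto intro: P1 mult)
  have Ppow: "P (r ^ n)" if "P r" for r n
    using that by (induction n) (auto intro: P1 mult)
  have "P (subst X p)"
    unfolding subst_def using assms by (intro Psum mult Pprod Ppow) auto
  then show ?thesis by (simp add: subst_id)
qed

lemma subst_subst: "subst \<sigma> (subst \<tau> p) = subst (\<lambda>j. subst \<sigma> (\<tau> j)) p"
  by (induction p rule: mpol_induct) (simp_all add: subst_hom)

lemma subst_cong:
  assumes "\<And>m j. m \<in> Poly_Mapping.keys p \<Longrightarrow> j \<in> Poly_Mapping.keys m \<Longrightarrow> \<sigma> j = \<tau> j"
  shows "subst \<sigma> p = subst \<tau> p"
  unfolding subst_def using assms by (intro sum.cong prod.cong arg_cong2[of _ _ _ _ "(*)"]) auto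

lemma subst_cong_Pk:
  assumes "p \<in> Pk k" "\<And>j. 1 \<le> j \<Longrightarrow> j \<le> k \<Longrightarrow> \<sigma> j = \<tau> j"
  shows "subst \<sigma> p = subst \<tau> p"
  by (rule subst_cong) (use assms in \<open>fastforce simp: Pk_def\<close>)


section \<open>Polynomials in k variables of bounded degree\<close>

definition Pk_deg :: "nat \<Rightarrow> nat \<Rightarrow> mpol set" where
  "Pk_deg k d = {p \<in> Pk k. \<forall>m\<in>Poly_Mapping.keys p. mon_degree m \<le> d}"

lemma mon_degree_superset:
  assumes "finite S" "Poly_Mapping.keys m \<subseteq> S"
  shows "mon_degree m = (\<Sum>j\<in>S. Poly_Mapping.lookup m j)"
  unfolding mon_degree_def
  by (rule sum.mono_neutral_left) (use assms in \<open>auto simp: in_keys_iff\<close>)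

lemma mon_degree_add: "mon_degree (m + n) = mon_degree m + mon_degree n"
proof -
  let ?S = "Poly_Mapping.keys m \<union> Poly_Mapping.keys n"
  have "mon_degree (m + n) = (\<Sum>j\<in>?S. Poly_Mapping.lookup (m + n) j)"
    by (rule mon_degree_superset) (use Poly_Mapping.keys_add[of m n] in auto)
  then show ?thesis
    by (simp add: mon_degree_superset[of ?S] lookup_add sum.distrib)
qed

lemma Pk_deg_mono: "p \<in> Pk_deg k d \<Longrightarrow> k \<le> k' \<Longrightarrow> d \<le> d' \<Longrightarrow> p \<in> Pk_deg k' d'"
  by (fastforce simp: Pk_deg_def Pk_def)

lemma Pk_deg_imp_Pk: "p \<in> Pk_deg k d \<Longrightarrow> p \<in> Pk k"
  by (simp add: Pk_deg_def)

lemma Pk_imp_Pk_deg: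
  assumes "p \<in> Pk k"
  obtains d where "p \<in> Pk_deg k d"
proof
  show "p \<in> Pk_deg k (\<Sum>m\<in>Poly_Mapping.keys p. mon_degree m)"
    using assms by (auto simp: Pk_deg_def intro: member_le_sum)
qed

lemma Pk_common_degree:
  assumes "p \<in> Pk k" "q \<in> Pk k"
  obtains d where "p \<in> Pk_deg k d" "q \<in> Pk_deg k d"
proof -
  obtain d where "p \<in> Pk_deg k d"
    using assms(1) by (rule Pk_imp_Pk_deg)
  moreover obtain e where "q \<in> Pk_deg k e"
    using assms(2) by (rule Pk_imp_Pk_deg)
  ultimately have "p \<in> Pk_deg k (max d e)" "q \<in> Pk_deg k (max d e)"
    by (auto elim: Pk_deg_mono)
  then show ?thesis by (rule that)
qed

lemma Pk_deg_0 [simp]: "0 \<in> Pk_deg k d"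
  by (simp add: Pk_deg_def Pk_def)

lemma Pk_deg_Const [simp]: "Const c \<in> Pk_deg k d"
  by (simp add: Pk_deg_def Pk_def Const_def mon_degree_def)

lemma Pk_deg_X: "1 \<le> j \<Longrightarrow> j \<le> k \<Longrightarrow> 1 \<le> d \<Longrightarrow> X j \<in> Pk_deg k d"
  by (simp add: Pk_deg_def Pk_def X_def mon_degree_def)

lemma Pk_deg_add: "p \<in> Pk_deg k d \<Longrightarrow> q \<in> Pk_deg k d \<Longrightarrow> p + q \<in> Pk_deg k d"
  using Poly_Mapping.keys_add[of p q] by (fastforce simp: Pk_deg_def Pk_def)

lemma Pk_deg_minus: "p \<in> Pk_deg k d \<Longrightarrow> - p \<in> Pk_deg k d"
  by (simp add: Pk_deg_def Pk_def in_keys_iff)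

lemma Pk_deg_diff: "p \<in> Pk_deg k d \<Longrightarrow> q \<in> Pk_deg k d \<Longrightarrow> p - q \<in> Pk_deg k d"
  using Pk_deg_add[of p k d "- q"] Pk_deg_minus by simp

lemma Pk_deg_sum: "(\<And>x. x \<in> A \<Longrightarrow> f x \<in> Pk_deg k d) \<Longrightarrow> sum f A \<in> Pk_deg k d"
  by (induction A rule: infinite_finite_induct) (auto intro: Pk_deg_add)

lemma Pk_deg_mult:
  assumes "p \<in> Pk_deg k a" "q \<in> Pk_deg k b"
  shows "p * q \<in> Pk_deg k (a + b)"
proof -
  have "Poly_Mapping.keys m \<subseteq> {1..k} \<and> mon_degree m \<le> a + b"
    if m: "m \<in> Poly_Mapping.keys (p * q)" for m
  proof -
    obtain u v where uv: "u \<in> Poly_Mapping.keys p" "v \<in> Poly_Mapping.keys q" "m = u + v"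
      using m keys_mult[of p q] by blast
    then show ?thesis
      using assms Poly_Mapping.keys_add[of u v]
      by (fastforce simp: Pk_deg_def Pk_def mon_degree_add intro: add_mono)
  qed
  then show ?thesis by (auto simp: Pk_deg_def Pk_def)
qed

lemma Pk_deg_Const_mult: "p \<in> Pk_deg k d \<Longrightarrow> Const c * p \<in> Pk_deg k d"
  using Pk_deg_mult[of "Const c" k 0 p d] by simp

lemma mon_eval_Pk_deg:
  assumes "\<And>j. j \<in> Poly_Mapping.keys m \<Longrightarrow> \<sigma> j \<in> Pk_deg k 1"
  shows "mon_eval \<sigma> m \<in> Pk_deg k (mon_degree m)"
proof -
  have pow: "r ^ n \<in> Pk_deg k n" if "r \<in> Pk_deg k 1" for r n
  proof (induction n)
    case 0
    then show ?case using Pk_deg_Const[of 1] by simp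
  next
    case (Suc n)
    then show ?case using Pk_deg_mult[OF that Suc] by simp
  qed
  have "(\<Prod>j\<in>A. \<sigma> j ^ Poly_Mapping.lookup m j) \<in> Pk_deg k (\<Sum>j\<in>A. Poly_Mapping.lookup m j)"
    if "finite A" "A \<subseteq> Poly_Mapping.keys m" for A
    using that
  proof (induction A)
    case empty
    then show ?case using Pk_deg_Const[of 1] by simp
  next
    case (insert x A)
    then show ?case using assms by (auto intro!: Pk_deg_mult pow)
  qed
  then show ?thesis by (simp add: mon_eval_def mon_degree_def)
qed

lemma subst_Pk_deg:
  assumes "p \<in> Pk_deg k d" "\<And>j. 1 \<le> j \<Longrightarrow> j \<le> k \<Longrightarrow> \<sigma> j \<in> Pk_deg k' 1"
  shows "subst \<sigma> p \<in> Pk_deg k' d"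
proof (subst subst_eq_sum[OF finite_keys subset_refl], rule Pk_deg_sum, rule Pk_deg_Const_mult)
  fix m assume m: "m \<in> Poly_Mapping.keys p"
  then have "mon_eval \<sigma> m \<in> Pk_deg k' (mon_degree m)"
    using assms by (intro mon_eval_Pk_deg) (auto simp: Pk_deg_def Pk_def subset_iff)
  then show "mon_eval \<sigma> m \<in> Pk_deg k' d"
    by (rule Pk_deg_mono) (use assms m in \<open>auto simp: Pk_deg_def\<close>)
qed

lemma X_inject [simp]: "X i = X j \<longleftrightarrow> i = j"
proof
  assume "X i = X j"
  then have "Poly_Mapping.keys (X i) = Poly_Mapping.keys (X j)" by simp
  then have "Poly_Mapping.single i (1::nat) = Poly_Mapping.single j 1"
    by (simp add: X_def)
  then have "Poly_Mapping.keys (Poly_Mapping.single i (1::nat)) = Poly_Mapping.keys (Poly_Mapping.single j (1::nat))"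
    by simp
  then show "i = j" by simp
qed simp

lemma X_neq_0 [simp]: "X i \<noteq> 0"
  by (metis X_def lookup_single_eq lookup_zero zero_neq_one)


section \<open>Divided differences and the rescaled inverse Demazure-Lusztig operators\<close>

lemmas swap_hom =
  subst_hom[of "\<lambda>j. X (Transposition.transpose i (Suc i) j)" for i, folded swap_def]

lemma swap_0 [simp]: "swap i 0 = 0"
  and swap_Const [simp]: "swap i (Const c) = Const c"
  and swap_1 [simp]: "swap i 1 = 1"
  and swap_X: "swap i (X j) = X (Transposition.transpose i (Suc i) j)"
  by (simp_all add: swap_def)

lemma swap_X_simps [simp]:
  "swap i (X i) = X (Suc i)" "swap i (X (Suc i)) = X i"
  "j \<noteq> i \<Longrightarrow> j \<noteq> Suc i \<Longrightarrow> swap i (X j) = X j"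
  by (simp_all add: swap_X)

lemma swap_swap [simp]: "swap i (swap i p) = p"
  unfolding swap_def subst_subst by (simp add: subst_id)

lemma subst_swap: "subst \<sigma> (swap i p) = subst (\<lambda>j. \<sigma> (Transposition.transpose i (Suc i) j)) p"
  by (simp add: swap_def subst_subst)

lemma swap_subst: "swap i (subst \<sigma> p) = subst (\<lambda>j. swap i (\<sigma> j)) p"
  by (simp add: swap_def subst_subst)

lemma swap_Pk_deg: "p \<in> Pk_deg k d \<Longrightarrow> 1 \<le> i \<Longrightarrow> i < k \<Longrightarrow> swap i p \<in> Pk_deg k d"
  unfolding swap_def
  by (erule subst_Pk_deg) (auto simp: Transposition.transpose_def intro!: Pk_deg_X)

definition divdiff :: "nat \<Rightarrow> mpol \<Rightarrow> mpol" where
  "divdiff i f = (THE g. g * (X i - X (Suc i)) = f - swap i f)"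

lemma divdiff_unique:
  assumes "g * (X i - X (Suc i)) = f - swap i f"
  shows "divdiff i f = g"
  unfolding divdiff_def
proof (rule the_equality)
  show "g * (X i - X (Suc i)) = f - swap i f" by (rule assms)
  fix g' assume "g' * (X i - X (Suc i)) = f - swap i f"
  then have "g' * (X i - X (Suc i)) = g * (X i - X (Suc i))"
    using assms by simp
  then show "g' = g" by simp
qed

lemma divdiff: "divdiff i f * (X i - X (Suc i)) = f - swap i f"
proof -
  have "\<exists>g. g * (X i - X (Suc i)) = f - swap i f"
  proof (induction f rule: mpol_induct)
    case (Const c)
    show ?case by (rule exI[of _ 0]) simp
  next
    case (X m j)
    consider "j = i" | "j = Suc i" | "j \<noteq> i" "j \<noteq> Suc i" by blast
    then show ?case
    proof cases
      case 1
      then show ?thesis by (intro exI[of _ 1]) simp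
    next
      case 2
      then show ?thesis by (intro exI[of _ "- 1"]) simp
    next
      case 3
      then show ?thesis by (intro exI[of _ 0]) simp
    qed
  next
    case (add p q)
    then obtain g h where "g * (X i - X (Suc i)) = p - swap i p" "h * (X i - X (Suc i)) = q - swap i q"
      by blast
    then show ?case
      by (intro exI[of _ "g + h"]) (simp add: swap_hom distrib_right)
  next
    case (mult p q)
    then obtain g h where "g * (X i - X (Suc i)) = p - swap i p" "h * (X i - X (Suc i)) = q - swap i q"
      by blast
    then have "(g * q + swap i p * h) * (X i - X (Suc i)) = p * q - swap i (p * q)"
      unfolding swap_hom by algebra
    then show ?case by blast
  qed
  then show ?thesis using divdiff_unique by metis
qed

lemma divdiff_Const [simp]: "divdiff i (Const c) = 0"
  and divdiff_1 [simp]: "divdiff i 1 = 0"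
  and divdiff_X: "divdiff i (X j) = (if j = i then 1 else if j = Suc i then - 1 else 0)"
  by (auto intro!: divdiff_unique)

lemma divdiff_add: "divdiff i (p + q) = divdiff i p + divdiff i q"
  by (rule divdiff_unique) (simp add: distrib_right divdiff swap_hom)

lemma divdiff_mult: "divdiff i (p * q) = divdiff i p * q + swap i p * divdiff i q"
  by (rule divdiff_unique) (use divdiff[of i p] divdiff[of i q] in \<open>unfold swap_hom, algebra\<close>)

lemma divdiff_Const_mult: "divdiff i (Const c * p) = Const c * divdiff i p"
  by (simp add: divdiff_mult)

lemma divdiff_sum: "divdiff i (sum f A) = (\<Sum>x\<in>A. divdiff i (f x))"
  using divdiff_Const[of i 0]
  by (induction A rule: infinite_finite_induct) (simp_all add: divdiff_add)

text \<open>
  Divided differences lower the degree by one. Multiplying by a variable states this without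
  subtracting degrees, and the product is what occurs in the operators. The twisted Leibniz rule
  gives the induction on the degree of the monomial.
\<close>

lemma X_mult_divdiff_mon_Pk_deg:
  assumes "Poly_Mapping.keys m \<subseteq> {1..k}" "1 \<le> i" "i < k" "1 \<le> l" "l \<le> k"
  shows "X l * divdiff i (mon_eval X m) \<in> Pk_deg k (mon_degree m)"
  using assms(1)
proof (induction "mon_degree m" arbitrary: m)
  case 0
  then have "m = 0"
    by (auto simp: mon_degree_def in_keys_iff intro: poly_mapping_eqI)
  then show ?case by (simp add: mon_eval_def)
next
  case (Suc n)
  then obtain j where j: "j \<in> Poly_Mapping.keys m"
    by (metis mon_degree_def sum.empty all_not_in_conv nat.distinct(1))
  define m' where "m' = m - Poly_Mapping.single j 1"
  have m: "m = Poly_Mapping.single j 1 + m'"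
    unfolding m'_def using j
    by (intro poly_mapping_eqI) (auto simp: lookup_add lookup_minus lookup_single when_def in_keys_iff)
  have deg: "mon_degree m = 1 + mon_degree m'"
    by (subst m, subst mon_degree_add) (simp add: mon_degree_def)
  have keys: "Poly_Mapping.keys m' \<subseteq> {1..k}"
    using Suc.prems unfolding m'_def
    by (auto simp: in_keys_iff lookup_minus subset_iff)
  have jk: "1 \<le> j" "j \<le> k"
    using j Suc.prems by auto
  have IH: "X l * divdiff i (mon_eval X m') \<in> Pk_deg k (mon_degree m')"
    using Suc.hyps deg keys by simp
  have "mon_eval X m = X j * mon_eval X m'"
    by (subst m, subst mon_eval_add) (simp add: mon_eval_X X_def)
  then have eq: "X l * divdiff i (mon_eval X m) =
      (X l * divdiff i (X j)) * mon_eval X m' + swap i (X j) * (X l * divdiff i (mon_eval X m'))"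
    by (simp add: divdiff_mult algebra_simps)
  have Xl: "X l \<in> Pk_deg k 1"
    using assms by (intro Pk_deg_X) auto
  have "X l * divdiff i (X j) \<in> Pk_deg k 1"
    using Xl by (simp add: divdiff_X Pk_deg_minus)
  moreover have "mon_eval X m' \<in> Pk_deg k (mon_degree m')"
    using keys by (intro mon_eval_Pk_deg Pk_deg_X) auto
  moreover have "swap i (X j) \<in> Pk_deg k 1"
    using assms jk by (intro swap_Pk_deg Pk_deg_X) auto
  ultimately show ?case
    unfolding eq deg using IH by (intro Pk_deg_add Pk_deg_mult)
qed

lemma X_mult_divdiff_Pk_deg:
  assumes "p \<in> Pk_deg k d" "1 \<le> i" "i < k" "1 \<le> l" "l \<le> k"
  shows "X l * divdiff i p \<in> Pk_deg k d"
proof -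
  have "X l * divdiff i p = (\<Sum>m\<in>Poly_Mapping.keys p.
      Const (Poly_Mapping.lookup p m) * (X l * divdiff i (mon_eval X m)))"
    by (subst sum_singles[of p])
       (simp add: divdiff_sum single_eq_mon_eval divdiff_Const_mult sum_distrib_left
                  mult.left_commute[of "X l"])
  also have "\<dots> \<in> Pk_deg k d"
  proof (intro Pk_deg_sum Pk_deg_Const_mult)
    fix m assume m: "m \<in> Poly_Mapping.keys p"
    then have "X l * divdiff i (mon_eval X m) \<in> Pk_deg k (mon_degree m)"
      using assms by (intro X_mult_divdiff_mon_Pk_deg) (auto simp: Pk_deg_def Pk_def)
    then show "X l * divdiff i (mon_eval X m) \<in> Pk_deg k d"
      by (rule Pk_deg_mono) (use assms m in \<open>auto simp: Pk_deg_def\<close>)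
  qed
  finally show ?thesis .
qed

lemma
  assumes "\<sigma> i = X i" "\<sigma> (Suc i) = X (Suc i)"
    and "\<And>j. j \<noteq> i \<Longrightarrow> j \<noteq> Suc i \<Longrightarrow> swap i (\<sigma> j) = \<sigma> j"
  shows subst_swap_commute: "subst \<sigma> (swap i p) = swap i (subst \<sigma> p)"
    and subst_divdiff: "subst \<sigma> (divdiff i p) = divdiff i (subst \<sigma> p)"
proof -
  have "(\<lambda>j. \<sigma> (Transposition.transpose i (Suc i) j)) = (\<lambda>j. swap i (\<sigma> j))"
    using assms by (auto simp: Transposition.transpose_def)
  then show *: "subst \<sigma> (swap i p) = swap i (subst \<sigma> p)"
    by (simp add: subst_swap swap_subst)
  have "subst \<sigma> (divdiff i p * (X i - X (Suc i))) = subst \<sigma> p - swap i (subst \<sigma> p)"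
    by (simp add: divdiff subst_hom *)
  then have "subst \<sigma> (divdiff i p) * (X i - X (Suc i)) = subst \<sigma> p - swap i (subst \<sigma> p)"
    by (simp add: subst_hom assms)
  then show "subst \<sigma> (divdiff i p) = divdiff i (subst \<sigma> p)"
    by (simp add: divdiff_unique)
qed

text \<open>
  This is t times the inverse of \<open>T\<^sub>i\<close>. Unlike the inverse itself it is regular at \<open>t = 0\<close>, so that
  the powers of t that make the sequences converge become visible.
\<close>

definition U :: "nat \<Rightarrow> mpol \<Rightarrow> mpol" where
  "U i f = Const t_var * swap i f + Const (1 - t_var) * X (Suc i) * divdiff i f"

lemma T_eq: "T i f = swap i f + Const (1 - t_var) * X i * divdiff i f"
  by (simp add: T_def divdiff_def)

lemma T_add: "T i (p + q) = T i p + T i q"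
  and T_Const_mult: "T i (Const c * p) = Const c * T i p"
  unfolding T_eq divdiff_add divdiff_Const_mult swap_hom swap_Const
  by (simp_all add: algebra_simps)

lemma U_Const_mult: "U i (Const c * p) = Const c * U i p"
  unfolding U_def divdiff_Const_mult swap_hom swap_Const by (simp add: algebra_simps)

lemma T_Pk_deg: "p \<in> Pk_deg k d \<Longrightarrow> 1 \<le> i \<Longrightarrow> i < k \<Longrightarrow> T i p \<in> Pk_deg k d"
  unfolding T_eq mult.assoc
  by (intro Pk_deg_add swap_Pk_deg Pk_deg_Const_mult X_mult_divdiff_Pk_deg) auto

lemma U_Pk_deg: "p \<in> Pk_deg k d \<Longrightarrow> 1 \<le> i \<Longrightarrow> i < k \<Longrightarrow> U i p \<in> Pk_deg k d"
  unfolding U_def mult.assoc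
  by (intro Pk_deg_add swap_Pk_deg Pk_deg_Const_mult X_mult_divdiff_Pk_deg) auto

lemma
  assumes "\<sigma> i = X i" "\<sigma> (Suc i) = X (Suc i)"
    and "\<And>j. j \<noteq> i \<Longrightarrow> j \<noteq> Suc i \<Longrightarrow> swap i (\<sigma> j) = \<sigma> j"
  shows subst_T: "subst \<sigma> (T i p) = T i (subst \<sigma> p)"
    and subst_U: "subst \<sigma> (U i p) = U i (subst \<sigma> p)"
  by (simp_all add: T_eq U_def subst_hom subst_swap_commute[OF assms] subst_divdiff[OF assms] assms)

text \<open>
  Multiplied by \<open>x\<^sub>i - x\<^sub>i\<^sub>+\<^sub>1\<close>, the operators become combinations of f and \<open>s\<^sub>i f\<close>. In an integral
  domain identities between operators can be checked after this multiplication, where they are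
  identities of the ring and no longer involve the divided difference.
\<close>

lemma T_mult_diff:
  "T i f * (X i - X (Suc i)) =
     (X i - X (Suc i)) * swap i f + (1 - Const t_var) * X i * (f - swap i f)"
  unfolding T_eq Const_diff Const_1 using divdiff[of i f] by algebra

lemma U_mult_diff:
  "U i f * (X i - X (Suc i)) =
     (1 - Const t_var) * X (Suc i) * f + (Const t_var * X i - X (Suc i)) * swap i f"
  unfolding U_def Const_diff Const_1 using divdiff[of i f] by algebra

lemma T_U: "T i (U i f) = Const t_var * f"
  and U_T: "U i (T i f) = Const t_var * f"
proof -
  let ?D = "X i - X (Suc i)" and ?t = "Const t_var"
  have D: "?D \<noteq> 0" by simp
  have sU: "swap i (U i f) * (X (Suc i) - X i) = (1 - ?t) * X i * swap i f + (?t * X (Suc i) - X i) * f"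
    using arg_cong[OF U_mult_diff[of i f], of "swap i"] by (simp add: swap_hom)
  have sT: "swap i (T i f) * (X (Suc i) - X i) = (X (Suc i) - X i) * f + (1 - ?t) * X (Suc i) * (swap i f - f)"
    using arg_cong[OF T_mult_diff[of i f], of "swap i"] by (simp add: swap_hom)
  have "T i (U i f) * ?D * ?D = ?t * f * ?D * ?D"
    using sU U_mult_diff[of i f] T_mult_diff[of i "U i f"] by algebra
  then show "T i (U i f) = ?t * f" using D by simp
  have "U i (T i f) * ?D * ?D = ?t * f * ?D * ?D"
    using sT T_mult_diff[of i f] U_mult_diff[of i "T i f"] by algebra
  then show "U i (T i f) = ?t * f" using D by simp
qed

lemma t_var_neq_0 [simp]: "t_var \<noteq> 0"
  by (simp add: t_var_def Zero_fract_def eq_fract)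

lemma q_var_neq_0 [simp]: "q_var \<noteq> 0"
  by (simp add: q_var_def Zero_fract_def eq_fract)

lemma T_inv_eq:
  assumes "p \<in> Pk_deg k d" "1 \<le> i" "i < k"
  shows "T_inv k i p = Const (1 / t_var) * U i p"
proof -
  have *: "Const (1 / t_var) * (Const t_var * f) = f" for f
    by (simp flip: mult.assoc Const_mult)
  have "inj_on (T i) (Pk k)"
    by (rule inj_on_inverseI[of _ "\<lambda>f. Const (1 / t_var) * U i f"]) (simp add: U_T *)
  moreover have "Const (1 / t_var) * U i p \<in> Pk k"
    using assms by (intro Pk_deg_imp_Pk Pk_deg_Const_mult U_Pk_deg)
  moreover have "T i (Const (1 / t_var) * U i p) = p"
    by (simp add: T_Const_mult T_U *)
  ultimately show ?thesis
    unfolding T_inv_def by (metis inv_into_f_f)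
qed

lemma fold_U_Pk_deg:
  assumes "p \<in> Pk_deg k d" "1 \<le> i" "j \<le> k"
  shows "fold U [i..<j] p \<in> Pk_deg k d"
  using assms(3)
proof (induction j)
  case (Suc j)
  then show ?case using assms by (auto intro!: U_Pk_deg)
qed (use assms in simp)

text \<open>
  The inverse is taken on the polynomials in k variables only, so the intermediate results must be
  known to remain there.
\<close>

lemma fold_T_inv:
  assumes "p \<in> Pk_deg k d" "1 \<le> i" "j \<le> k"
  shows "fold (T_inv k) [i..<j] p = Const (1 / t_var ^ (j - i)) * fold U [i..<j] p"
  using assms(3)
proof (induction j)
  case (Suc j)
  show ?case
  proof (cases "i \<le> j")
    case True
    have "fold U [i..<j] p \<in> Pk_deg k d"
      using assms Suc by (intro fold_U_Pk_deg) auto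
    then have "Const (1 / t_var ^ (j - i)) * fold U [i..<j] p \<in> Pk_deg k d"
      by (rule Pk_deg_Const_mult)
    then have "T_inv k j (fold (T_inv k) [i..<j] p) =
        Const (1 / t_var) * U j (Const (1 / t_var ^ (j - i)) * fold U [i..<j] p)"
      using Suc assms True by (simp add: T_inv_eq)
    then show ?thesis
      using True by (simp add: U_Const_mult Suc_diff_le flip: mult.assoc Const_mult)
  qed simp
qed simp


section \<open>Symmetry of iterated operators\<close>

lemma swap_braid: "swap i (swap (Suc i) (swap i f)) = swap (Suc i) (swap i (swap (Suc i) f))"
  unfolding swap_def subst_subst by (rule subst_cong) (auto simp: Transposition.transpose_def)

lemma
  assumes "i + 2 \<le> j \<or> j + 2 \<le> i"
  shows swap_T_commute: "swap i (T j f) = T j (swap i f)"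
    and swap_U_commute: "swap i (U j f) = U j (swap i f)"
proof -
  have "swap j (X (Transposition.transpose i (Suc i) l)) = X (Transposition.transpose i (Suc i) l)"
    if "l \<noteq> j" "l \<noteq> Suc j" for l
    using that assms by (auto simp: Transposition.transpose_def)
  moreover have "X (Transposition.transpose i (Suc i) j) = X j"
    "X (Transposition.transpose i (Suc i) (Suc j)) = X (Suc j)"
    using assms by (auto simp: Transposition.transpose_def)
  ultimately show "swap i (T j f) = T j (swap i f)" "swap i (U j f) = U j (swap i f)"
    unfolding swap_def[of i] by (intro subst_T subst_U; simp)+
qed

text \<open>
  Write x, y, z for the three variables involved and b, c for the conjugates of f in which y and z,
  respectively, take the place of x. After clearing denominators, \<open>U\<^sub>i\<^sub>+\<^sub>1 U\<^sub>i f\<close> is an explicit combination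
  of f, b and c which the exchange of x and y turns into its negative, as it does the denominator.
  This avoids the braid relation for the operators themselves.
\<close>

lemma swap_U_U:
  assumes f: "swap (Suc i) f = f"
  shows "swap i (U (Suc i) (U i f)) = U (Suc i) (U i f)"
proof -
  define t x y z where "t = Const t_var" "x = X i" "y = X (Suc i)" "z = X (Suc (Suc i))"
  define b c G H where "b = swap i f" "c = swap (Suc i) b" "G = U i f" "H = U (Suc i) G"
  note defs = t_x_y_z_def b_c_G_H_def
  have c: "swap i c = c"
    unfolding defs by (simp add: swap_braid f)
  have G: "G * (x - y) = (1 - t) * y * f + (t * x - y) * b"
    unfolding defs by (rule U_mult_diff)
  have sG: "swap (Suc i) G * (x - z) = (1 - t) * z * f + (t * x - z) * c"
    using arg_cong[OF G, of "swap (Suc i)"] unfolding defs by (simp add: swap_hom f)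
  have H: "H * (y - z) = (1 - t) * z * G + (t * y - z) * swap (Suc i) G"
    unfolding defs by (rule U_mult_diff)
  have 1: "H * ((x - y) * (x - z) * (y - z)) =
      (1 - t) * z * (x - t * y) * (y - z) * f + (1 - t) * z * (t * x - y) * (x - z) * b
      + (t * x - z) * (t * y - z) * (x - y) * c" (is "_ = ?N")
    using G sG H by algebra
  have "swap i H * ((y - x) * (y - z) * (x - z)) =
      (1 - t) * z * (y - t * x) * (x - z) * b + (1 - t) * z * (t * y - x) * (y - z) * f
      + (t * y - z) * (t * x - z) * (y - x) * c"
    using arg_cong[OF 1, of "swap i"] c unfolding defs by (simp add: swap_hom)
  then have "swap i H * ((x - y) * (x - z) * (y - z)) = ?N"
    by algebra
  then have "swap i H * ((x - y) * (x - z) * (y - z)) = H * ((x - y) * (x - z) * (y - z))"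
    using 1 by simp
  moreover have "(x - y) * (x - z) * (y - z) \<noteq> 0"
    unfolding defs by simp
  ultimately show ?thesis
    unfolding defs by simp
qed

lemma swap_fold_U_commute:
  assumes "\<And>j. j \<in> set js \<Longrightarrow> i + 2 \<le> j \<or> j + 2 \<le> i"
  shows "swap i (fold U js f) = fold U js (swap i f)"
  using assms by (induction js arbitrary: f) (auto simp: swap_U_commute)

text \<open>
  The operators before \<open>U\<^sub>j\<close> preserve the symmetry of f, the two operators \<open>U\<^sub>j\<^sub>+\<^sub>1 U\<^sub>j\<close> move it one
  position down, and the later ones preserve it there.
\<close>

lemma swap_fold_U:
  assumes "swap (Suc j) f = f" "i \<le> j" "j + 2 \<le> k"
  shows "swap j (fold U [i..<k] f) = fold U [i..<k] f"
proof -
  have "[i..<k] = [i..<j] @ [j, Suc j] @ [j + 2..<k]"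
  proof -
    have "[i..<k] = [i..<j] @ [j..<k]"
      using assms upt_add_eq_append[of i j "k - j"] by simp
    also have "[j..<k] = [j, Suc j] @ [j + 2..<k]"
      using assms by (simp add: upt_conv_Cons)
    finally show ?thesis .
  qed
  moreover have "swap (Suc j) (fold U [i..<j] f) = fold U [i..<j] f"
    using assms by (subst swap_fold_U_commute) auto
  moreover have "swap j (fold U [j + 2..<k] g) = fold U [j + 2..<k] (swap j g)" for g
    by (rule swap_fold_U_commute) auto
  ultimately show ?thesis
    by (simp add: swap_U_U del: upt_Suc)
qed


section \<open>Eventually compatible and symmetric families\<close>

text \<open>
  The components with index at least K of an almost symmetric formal polynomial: the earlier
  components are arbitrary. The operators of interest commute with the projections and the
  transpositions only for large indices, so this is the notion that they preserve.
\<close>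

definition stable_from :: "nat \<Rightarrow> fpol \<Rightarrow> bool" where
  "stable_from K F \<longleftrightarrow> (\<exists>d. \<forall>k\<ge>K. F k \<in> Pk_deg k d) \<and>
     (\<forall>k\<ge>K. proj (Suc k) (F (Suc k)) = F k) \<and>
     (\<forall>j k. K \<le> j \<longrightarrow> j < k \<longrightarrow> swap j (F k) = F k)"

lemma stable_from_mono: "stable_from K F \<Longrightarrow> K \<le> K' \<Longrightarrow> stable_from K' F"
  unfolding stable_from_def by (meson order_trans)

lemma trunc_Pk: "p \<in> Pk k \<Longrightarrow> trunc k p = p"
  unfolding trunc_def by (subst subst_cong_Pk[of p k _ X]) (auto simp: subst_id)

lemma trunc_Pk_deg:
  assumes "p \<in> Pk_deg n d"
  shows "trunc k p \<in> Pk_deg k d"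
  unfolding trunc_def by (rule subst_Pk_deg[OF assms]) (auto intro!: Pk_deg_X)

lemma Pas_imp_stable_from:
  assumes "F \<in> Pas"
  obtains K where "stable_from K F"
proof -
  obtain m where m: "F \<in> Psym m"
    using assms by (auto simp: Pas_def)
  then have Pinf: "F \<in> Pinf"
    by (simp add: Psym_def)
  have "swap j (F k) = F k" if "Suc m \<le> j" "j < k" for j k
  proof -
    have "swap_inf j F k = F k"
      using m that by (auto simp: Psym_def)
    then have "trunc k (swap j (F k)) = F k"
      using that by (simp add: swap_inf_def max_absorb1)
    moreover have "swap j (F k) \<in> Pk k"
    proof -
      have "F k \<in> Pk k" using Pinf by (simp add: Pinf_def)
      then obtain d where "F k \<in> Pk_deg k d" by (rule Pk_imp_Pk_deg)
      then show ?thesis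
        using that by (intro Pk_deg_imp_Pk swap_Pk_deg) auto
    qed
    ultimately show ?thesis by (simp add: trunc_Pk)
  qed
  moreover have "proj (Suc k) (F (Suc k)) = F k" for k
    using Pinf by (fastforce simp: Pinf_def)
  moreover have "\<exists>d. \<forall>k. F k \<in> Pk_deg k d"
    using Pinf by (auto simp: Pinf_def Pk_deg_def)
  ultimately have "stable_from (Suc m) F"
    by (auto simp: stable_from_def)
  then show ?thesis by (rule that)
qed

lemma trunc_stable_from:
  assumes F: "stable_from K F" and "K \<le> n" "n \<le> n'" "k \<le> n"
  shows "trunc k (F n') = trunc k (F n)"
  using \<open>n \<le> n'\<close>
proof (induction n' rule: dec_induct)
  case (step l)
  have "trunc k (proj (Suc l) (F (Suc l))) = trunc k (F (Suc l))"
    unfolding trunc_def proj_def subst_subst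
    by (rule subst_cong) (use step assms in auto)
  then show ?case
    using F step assms by (simp add: stable_from_def)
qed simp

text \<open>
  The components with index below K are forced to be truncations of the component with index K.
\<close>

lemma stable_from_extend:
  assumes F: "stable_from K F"
  obtains G where "G \<in> Pas" "\<And>k. K \<le> k \<Longrightarrow> G k = F k"
proof
  define G where "G = (\<lambda>k. trunc k (F (max k K)))"
  obtain d where d: "\<And>k. K \<le> k \<Longrightarrow> F k \<in> Pk_deg k d"
    using F by (auto simp: stable_from_def)
  show GF: "G k = F k" if "K \<le> k" for k
    using that d[OF that] by (simp add: G_def max_absorb1 trunc_Pk Pk_deg_imp_Pk)
  have Gdeg: "G k \<in> Pk_deg k d" for k
    unfolding G_def by (rule trunc_Pk_deg[OF d]) simp
  have "proj k (G k) = G (k - 1)" if "k \<ge> 1" for k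
  proof -
    have "proj k (G k) = trunc (k - 1) (F (max k K))"
      unfolding G_def trunc_def proj_def subst_subst
      by (rule subst_cong) (use that in auto)
    also have "\<dots> = trunc (k - 1) (F (max (k - 1) K))"
      by (rule trunc_stable_from[OF F]) auto
    finally show ?thesis by (simp add: G_def)
  qed
  then have "G \<in> Pinf"
    using Gdeg by (auto simp: Pinf_def Pk_deg_def)
  moreover have "swap_inf j G = G" if "j > K" for j
  proof
    fix k
    let ?n = "max k (Suc j)"
    have "swap j (G ?n) = F ?n"
      using that F by (simp add: GF stable_from_def)
    then have "swap_inf j G k = trunc k (F ?n)"
      by (simp add: swap_inf_def)
    also have "\<dots> = trunc k (F (max k K))"
      by (rule trunc_stable_from[OF F]) (use that in auto)
    finally show "swap_inf j G k = G k"
      by (simp add: G_def)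
  qed
  ultimately show "G \<in> Pas"
    by (auto simp: Pas_def Psym_def)
qed

text \<open>
  A polynomial in n variables is itself a formal polynomial symmetric in the variables after the
  n-th. These families serve to change single terms of a convergent sequence.
\<close>

lemma Pas_with_component:
  assumes "p \<in> Pk n"
  obtains G where "G \<in> Pas" "G n = p"
proof -
  have proj: "proj (Suc k) p = p" if "n \<le> k" for k
    unfolding proj_def using that
    by (subst subst_cong_Pk[OF assms, of _ X]) (auto simp: subst_id)
  have swap: "swap j p = p" if "n < j" for j
    unfolding swap_def using that
    by (subst subst_cong_Pk[OF assms, of _ X]) (auto simp: subst_id)
  obtain d where "p \<in> Pk_deg n d"
    using assms by (rule Pk_imp_Pk_deg)
  then have "stable_from (Suc n) (\<lambda>k. p)"
    using proj swap by (auto simp: stable_from_def intro!: exI[of _ d] elim: Pk_deg_mono)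
  then obtain G where G: "G \<in> Pas" "\<And>k. Suc n \<le> k \<Longrightarrow> G k = p"
    using stable_from_extend by blast
  then have "G n = proj (Suc n) (G (Suc n))"
    by (fastforce simp: Pas_def Psym_def Pinf_def)
  then have "G n = p"
    using G proj by simp
  then show ?thesis using G that by blast
qed

lemma stable_from_Const_mult:
  assumes F: "stable_from K F"
  shows "stable_from K (\<lambda>k. Const c * F k)"
proof -
  obtain d where "\<And>k. K \<le> k \<Longrightarrow> F k \<in> Pk_deg k d"
    using F by (auto simp: stable_from_def)
  then have "\<exists>d. \<forall>k\<ge>K. Const c * F k \<in> Pk_deg k d"
    by (intro exI[of _ d]) (auto intro: Pk_deg_Const_mult)
  then show ?thesis
    using F by (simp add: stable_from_def proj_def swap_hom subst_hom)
qed

lemma stable_from_T: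
  assumes F: "stable_from K F" and "1 \<le> j" "j + 2 \<le> K"
  shows "stable_from K (\<lambda>k. T j (F k))"
proof -
  have "proj (Suc k) (T j (F (Suc k))) = T j (F k)" if "K \<le> k" for k
  proof -
    have "proj (Suc k) (T j p) = T j (proj (Suc k) p)" for p
      unfolding proj_def using assms that by (intro subst_T) auto
    then show ?thesis using F that by (simp add: stable_from_def)
  qed
  moreover have "swap l (T j (F k)) = T j (F k)" if "K \<le> l" "l < k" for k l
    using F that assms by (simp add: stable_from_def swap_T_commute)
  moreover have "\<exists>d. \<forall>k\<ge>K. T j (F k) \<in> Pk_deg k d"
  proof -
    obtain d where "\<And>k. K \<le> k \<Longrightarrow> F k \<in> Pk_deg k d"
      using F by (auto simp: stable_from_def)
    then show ?thesis
      using assms by (intro exI[of _ d]) (auto intro!: T_Pk_deg)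
  qed
  ultimately show ?thesis
    by (simp add: stable_from_def)
qed

lemma stable_from_fold_T:
  assumes "stable_from K F" "i + 1 \<le> K"
  shows "stable_from K (\<lambda>k. fold T [1..<i] (F k))"
  using assms(2)
proof (induction i)
  case (Suc i)
  show ?case
  proof (cases "1 \<le> i")
    case True
    then show ?thesis
      using Suc stable_from_T[of K "\<lambda>k. fold T [1..<i] (F k)" i] by simp
  qed (use assms in simp)
qed (use assms in simp)

lemma fold_T_add: "fold T js (p + q) = fold T js p + fold T js q"
  and fold_T_Const_mult: "fold T js (Const c * p) = Const c * fold T js p"
  by (induction js arbitrary: p q) (simp_all add: T_add T_Const_mult)

lemma fold_T_Pk_deg:
  assumes "p \<in> Pk_deg k d" "i \<le> k"
  shows "fold T [1..<i] p \<in> Pk_deg k d"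
  using assms(2)
proof (induction i)
  case (Suc i)
  then show ?case using assms by (auto intro!: T_Pk_deg)
qed (use assms in simp)


section \<open>Evaluation at zero of the iterated operators\<close>

lemma subst_U_Suc_zero:
  assumes "\<sigma> (Suc j) = 0"
  shows "subst \<sigma> (U j f) = Const t_var * subst \<sigma> (swap j f)"
  using assms by (simp add: U_def subst_hom)

text \<open>
  At \<open>x\<^sub>j = 0\<close> the factor \<open>x\<^sub>j\<^sub>+\<^sub>1\<close> of the divided difference cancels against its denominator
  \<open>x\<^sub>j - x\<^sub>j\<^sub>+\<^sub>1\<close>, so no power of t appears in front of \<open>s\<^sub>j f\<close>: this term survives in the limit.
\<close>

lemma subst_U_zero:
  assumes "\<sigma> j = 0" "\<sigma> (Suc j) \<noteq> 0"
  shows "subst \<sigma> (U j f) = subst \<sigma> (swap j f) - Const (1 - t_var) * subst \<sigma> f"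
proof -
  have "subst \<sigma> (U j f) * (- \<sigma> (Suc j)) =
      (subst \<sigma> (swap j f) - Const (1 - t_var) * subst \<sigma> f) * (- \<sigma> (Suc j))"
    using arg_cong[OF U_mult_diff[of j f], of "subst \<sigma>"] assms(1)
    by (simp add: subst_hom Const_diff algebra_simps)
  then show ?thesis
    using assms(2) by simp
qed

text \<open>
  Each operator moves the zero one position to the left, with a factor t, and shifts the value that
  it passes to the right.
\<close>

lemma subst_fold_U_zero:
  assumes "\<sigma> j = 0" "i \<le> j"
  shows "subst \<sigma> (fold U [i..<j] f) = Const (t_var ^ (j - i)) *
    subst (\<lambda>l. if l < i then \<sigma> l else if l = i then 0 else if l \<le> j then \<sigma> (l - 1) else \<sigma> l) f"
  using assms(2,1)
proof (induction j arbitrary: \<sigma> rule: dec_induct)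
  case base
  have "(\<lambda>l. if l < i then \<sigma> l else if l = i then 0 else if l \<le> i then \<sigma> (l - 1) else \<sigma> l) = \<sigma>"
    using base by auto
  then show ?case by simp
next
  case (step j)
  let ?\<tau> = "\<lambda>l. \<sigma> (Transposition.transpose j (Suc j) l)"
  have "subst \<sigma> (fold U [i..<Suc j] f) = Const t_var * subst ?\<tau> (fold U [i..<j] f)"
    using step by (simp add: subst_U_Suc_zero subst_swap)
  also have "subst ?\<tau> (fold U [i..<j] f) = Const (t_var ^ (j - i)) *
      subst (\<lambda>l. if l < i then ?\<tau> l else if l = i then 0 else if l \<le> j then ?\<tau> (l - 1) else ?\<tau> l) f"
    by (rule step.IH) (use step in simp)
  also have "(\<lambda>l. if l < i then ?\<tau> l else if l = i then 0 else if l \<le> j then ?\<tau> (l - 1) else ?\<tau> l) =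
      (\<lambda>l. if l < i then \<sigma> l else if l = i then 0 else if l \<le> Suc j then \<sigma> (l - 1) else \<sigma> l)"
    using step.hyps by (auto simp: Transposition.transpose_def fun_eq_iff)
  finally show ?case
    using step.hyps by (simp add: Suc_diff_le Const_mult mult.assoc)
qed

text \<open>
  The points \<open>(x\<^sub>2, \<dots>, x\<^sub>i, 0, x\<^sub>i\<^sub>+\<^sub>1, x\<^sub>i\<^sub>+\<^sub>2, \<dots>)\<close> and
  \<open>(x\<^sub>2, \<dots>, x\<^sub>i, 0, x\<^sub>i\<^sub>+\<^sub>1, \<dots>, x\<^sub>k, q x\<^sub>1)\<close>, for \<open>i \<le> k\<close>, at which polynomials are evaluated.
\<close>

definition zero_insertion :: "nat \<Rightarrow> nat \<Rightarrow> mpol" where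
  "zero_insertion i l = (if l < i then X (Suc l) else if l = i then 0 else X l)"

definition cyclic_zero_insertion :: "nat \<Rightarrow> nat \<Rightarrow> nat \<Rightarrow> mpol" where
  "cyclic_zero_insertion i k l = (if l \<le> k then zero_insertion i l else Const q_var * X 1)"

lemma omega_inv_Pk_deg:
  assumes "p \<in> Pk_deg k d" "1 \<le> k"
  shows "omega_inv k p \<in> Pk_deg k d"
  unfolding omega_inv_def
  by (rule subst_Pk_deg[OF assms(1)]) (use assms(2) in \<open>auto intro!: Pk_deg_X Pk_deg_Const_mult\<close>)

lemma proj_fold_U:
  assumes "j \<le> k"
  shows "proj (Suc k) (fold U [i..<j] f) = fold U [i..<j] (proj (Suc k) f)"
  using assms
proof (induction j)
  case (Suc j)
  have "proj (Suc k) (U j p) = U j (proj (Suc k) p)" for p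
    unfolding proj_def using Suc by (intro subst_U) auto
  then show ?case using Suc by simp
qed simp

text \<open>
  After the cyclic shift, setting the last variable to zero means setting the last but one variable
  of \<open>U\<^sub>k G\<close> to zero, where \<open>G = U\<^sub>k\<^sub>-\<^sub>1 \<cdots> U\<^sub>i f\<close>. This produces the expected term, in which \<open>U\<^sub>k\<close> has disappeared,
  and a defect, in which the zero travels through G and leaves a power of t behind.
\<close>

lemma proj_omega_inv_fold_U:
  assumes f: "f \<in> Pk_deg (Suc k) d" and i: "1 \<le> i" "i \<le> k"
  shows "proj (Suc k) (omega_inv (Suc k) (fold U [i..<Suc k] f)) =
    omega_inv k (fold U [i..<k] (proj (Suc k) f))
    - Const ((1 - t_var) * t_var ^ (k - i)) * subst (cyclic_zero_insertion i k) f"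
proof -
  define G where "G = fold U [i..<k] f"
  define \<sigma> where "\<sigma> l = (if l < k then X (Suc l) else if l = k then 0 else Const q_var * X 1)" for l
  have G: "G \<in> Pk_deg (Suc k) d" and UG: "U k G \<in> Pk_deg (Suc k) d"
    unfolding G_def using f i by (auto intro!: U_Pk_deg fold_U_Pk_deg)
  have "proj (Suc k) (omega_inv (Suc k) (fold U [i..<Suc k] f)) = subst \<sigma> (U k G)"
    unfolding proj_def omega_inv_def subst_subst using i
    by (simp add: G_def[symmetric], intro subst_cong_Pk[OF Pk_deg_imp_Pk[OF UG]])
       (auto simp: \<sigma>_def subst_hom)
  also have "\<dots> = subst \<sigma> (swap k G) - Const (1 - t_var) * subst \<sigma> G"
    by (rule subst_U_zero) (auto simp: \<sigma>_def)
  also have "subst \<sigma> (swap k G) = omega_inv k (proj (Suc k) G)"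
    unfolding subst_swap proj_def omega_inv_def subst_subst
    by (rule subst_cong_Pk[OF Pk_deg_imp_Pk[OF G]])
       (auto simp: \<sigma>_def Transposition.transpose_def)
  also have "proj (Suc k) G = fold U [i..<k] (proj (Suc k) f)"
    unfolding G_def by (rule proj_fold_U) simp
  also have "subst \<sigma> G = Const (t_var ^ (k - i)) * subst (cyclic_zero_insertion i k) f"
  proof -
    have "subst \<sigma> G = Const (t_var ^ (k - i)) *
        subst (\<lambda>l. if l < i then \<sigma> l else if l = i then 0 else if l \<le> k then \<sigma> (l - 1) else \<sigma> l) f"
      unfolding G_def by (rule subst_fold_U_zero) (use i in \<open>simp_all add: \<sigma>_def\<close>)
    also have "subst (\<lambda>l. if l < i then \<sigma> l else if l = i then 0 else if l \<le> k then \<sigma> (l - 1) else \<sigma> l) f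
        = subst (cyclic_zero_insertion i k) f"
      by (rule subst_cong_Pk[OF Pk_deg_imp_Pk[OF f]])
         (use i in \<open>auto simp: \<sigma>_def cyclic_zero_insertion_def zero_insertion_def\<close>)
    finally show ?thesis .
  qed
  finally show ?thesis by (simp add: Const_mult mult.assoc)
qed

text \<open>
  Removing the monomials without \<open>x\<^sub>1\<close> is subtracting the value at \<open>x\<^sub>1 = 0\<close>. In this form the map can
  be combined with other substitutions.
\<close>

lemma pr1_eq: "pr1 p = p - subst (\<lambda>j. if j = 1 then 0 else X j) p"
proof -
  let ?\<sigma> = "\<lambda>j. if j = 1 then 0 else X j" and ?K = "Poly_Mapping.keys p"
  have ev: "mon_eval ?\<sigma> m = (if 1 \<in> Poly_Mapping.keys m then 0 else mon_eval X m)" for m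
  proof (cases "1 \<in> Poly_Mapping.keys m")
    case True
    then have "(\<Prod>j\<in>Poly_Mapping.keys m. ?\<sigma> j ^ Poly_Mapping.lookup m j) = 0"
      by (intro prod_zero bexI[of _ 1]) (auto simp: in_keys_iff power_0_left)
    then show ?thesis using True by (simp add: mon_eval_def)
  next
    case False
    then show ?thesis
      unfolding mon_eval_def by (auto intro!: prod.cong)
  qed
  have "p - subst ?\<sigma> p = subst X p - subst ?\<sigma> p"
    by (simp add: subst_id)
  also have "\<dots> = (\<Sum>m\<in>?K. if 1 \<in> Poly_Mapping.keys m
                       then Const (Poly_Mapping.lookup p m) * mon_eval X m else 0)"
    unfolding subst_eq_sum[OF finite_keys subset_refl] ev sum_subtractf[symmetric]
    by (rule sum.cong) simp_all
  also have "\<dots> = pr1 p"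
    by (simp add: pr1_def sum.inter_filter single_eq_mon_eval)
  finally show ?thesis by simp
qed

text \<open>
  The cyclic shift sends the last variable to \<open>q x\<^sub>1\<close>. So \<open>x\<^sub>1 = 0\<close> means that the last variable
  of \<open>U\<^sub>k\<^sub>-\<^sub>1 \<cdots> U\<^sub>i f\<close> is zero, and the zero travels through all the operators.
\<close>

lemma pr1_omega_inv_fold_U:
  assumes f: "f \<in> Pk_deg k d" and i: "1 \<le> i" "i \<le> k"
  shows "pr1 (omega_inv k (fold U [i..<k] f)) =
    omega_inv k (fold U [i..<k] f) - Const (t_var ^ (k - i)) * subst (zero_insertion i) f"
proof -
  define G where "G = fold U [i..<k] f"
  define \<sigma> where "\<sigma> l = (if l < k then X (Suc l) else 0)" for l
  have G: "G \<in> Pk_deg k d"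
    unfolding G_def using f i by (auto intro!: fold_U_Pk_deg)
  have "subst (\<lambda>j. if j = 1 then 0 else X j) (omega_inv k G) = subst \<sigma> G"
    unfolding omega_inv_def subst_subst
    by (rule subst_cong_Pk[OF Pk_deg_imp_Pk[OF G]]) (auto simp: \<sigma>_def subst_hom)
  also have "\<dots> = Const (t_var ^ (k - i)) *
      subst (\<lambda>l. if l < i then \<sigma> l else if l = i then 0 else if l \<le> k then \<sigma> (l - 1) else \<sigma> l) f"
    unfolding G_def by (rule subst_fold_U_zero) (use i in \<open>simp_all add: \<sigma>_def\<close>)
  also have "subst (\<lambda>l. if l < i then \<sigma> l else if l = i then 0 else if l \<le> k then \<sigma> (l - 1) else \<sigma> l) f
      = subst (zero_insertion i) f"
    by (rule subst_cong_Pk[OF Pk_deg_imp_Pk[OF f]]) (use i in \<open>auto simp: \<sigma>_def zero_insertion_def\<close>)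
  finally show ?thesis by (simp add: pr1_eq G_def)
qed

lemma zero_insertion_Pk_deg:
  "1 \<le> l \<Longrightarrow> l \<le> k \<Longrightarrow> i \<le> k \<Longrightarrow> zero_insertion i l \<in> Pk_deg k 1"
  by (auto simp: zero_insertion_def intro!: Pk_deg_X)

lemma cyclic_zero_insertion_Pk_deg:
  "1 \<le> l \<Longrightarrow> 1 \<le> k \<Longrightarrow> i \<le> k \<Longrightarrow> cyclic_zero_insertion i k l \<in> Pk_deg k 1"
  using zero_insertion_Pk_deg[of l k i]
  by (auto simp: cyclic_zero_insertion_def intro!: Pk_deg_X Pk_deg_Const_mult)

lemma stable_from_zero_insertion:
  assumes F: "stable_from K F" and K: "i < K"
  shows "stable_from K (\<lambda>k. subst (zero_insertion i) (F k))"
proof -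
  obtain d where d: "\<And>k. K \<le> k \<Longrightarrow> F k \<in> Pk_deg k d"
    using F by (auto simp: stable_from_def)
  have "proj (Suc k) (subst (zero_insertion i) (F (Suc k))) = subst (zero_insertion i) (F k)"
    if "K \<le> k" for k
  proof -
    have "F k = proj (Suc k) (F (Suc k))"
      using F that by (simp add: stable_from_def)
    moreover have "proj (Suc k) (subst (zero_insertion i) p) = subst (zero_insertion i) (proj (Suc k) p)" for p
      unfolding proj_def subst_subst
      by (rule subst_cong) (use K that in \<open>auto simp: zero_insertion_def\<close>)
    ultimately show ?thesis by simp
  qed
  moreover have "swap j (subst (zero_insertion i) (F k)) = subst (zero_insertion i) (F k)"
    if "K \<le> j" "j < k" for j k
  proof -
    have "F k = swap j (F k)"
      using F that by (simp add: stable_from_def)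
    moreover have "swap j (subst (zero_insertion i) p) = subst (zero_insertion i) (swap j p)" for p
      unfolding swap_subst subst_swap
      by (rule subst_cong) (use K that in \<open>auto simp: zero_insertion_def swap_X Transposition.transpose_def\<close>)
    ultimately show ?thesis by simp
  qed
  moreover have "\<forall>k\<ge>K. subst (zero_insertion i) (F k) \<in> Pk_deg k d"
    using d K by (auto intro!: subst_Pk_deg zero_insertion_Pk_deg)
  ultimately show ?thesis
    unfolding stable_from_def by blast
qed

text \<open>
  The value \<open>q x\<^sub>1\<close> stands at a position that moves with k. Compatibility therefore needs the symmetry
  of the component with \<open>k + 2\<close> variables in the last two of them, which puts the zero of the
  projection last and \<open>q x\<^sub>1\<close> before it.
\<close>

lemma stable_from_cyclic_zero_insertion:
  assumes F: "stable_from K F" and i: "1 \<le> i" and K: "i < K"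
  shows "stable_from K (\<lambda>k. subst (cyclic_zero_insertion i k) (F (Suc k)))"
proof -
  let ?g = "cyclic_zero_insertion i"
  obtain d where d: "\<And>k. K \<le> k \<Longrightarrow> F k \<in> Pk_deg k d"
    using F by (auto simp: stable_from_def)
  have "proj (Suc k) (subst (?g (Suc k)) (F (Suc (Suc k)))) = subst (?g k) (F (Suc k))"
    if k: "K \<le> k" for k
  proof -
    let ?f = "F (Suc (Suc k))"
    have "F (Suc k) = proj (Suc (Suc k)) ?f"
      using F that by (simp add: stable_from_def)
    moreover have "?f = swap (Suc k) ?f"
      using F that by (simp add: stable_from_def)
    moreover have "proj (Suc k) (subst (?g (Suc k)) (swap (Suc k) ?f)) = subst (?g k) (proj (Suc (Suc k)) ?f)"
      unfolding proj_def subst_swap subst_subst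
    proof (rule subst_cong_Pk[OF Pk_deg_imp_Pk[OF d]])
      fix j assume j: "1 \<le> j" "j \<le> Suc (Suc k)"
      show "subst (\<lambda>j. if j = Suc k then 0 else X j)
          (?g (Suc k) (Transposition.transpose (Suc k) (Suc (Suc k)) j)) =
          subst (?g k) (if j = Suc (Suc k) then 0 else X j)"
        using i K k j
        by (cases "j = Suc k"; cases "j = Suc (Suc k)")
           (auto simp: cyclic_zero_insertion_def zero_insertion_def subst_hom Transposition.transpose_def)
    qed (use k in simp)
    ultimately show ?thesis by simp
  qed
  moreover have "swap j (subst (?g k) (F (Suc k))) = subst (?g k) (F (Suc k))"
    if "K \<le> j" "j < k" for j k
  proof -
    have "F (Suc k) = swap j (F (Suc k))"
      using F that by (simp add: stable_from_def)
    moreover have "swap j (subst (?g k) p) = subst (?g k) (swap j p)" for p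
      unfolding swap_subst subst_swap
      by (rule subst_cong) (use i K that in \<open>auto simp: cyclic_zero_insertion_def zero_insertion_def
          swap_X swap_hom Transposition.transpose_def\<close>)
    ultimately show ?thesis by simp
  qed
  moreover have "subst (?g k) (F (Suc k)) \<in> Pk_deg k d" if "K \<le> k" for k
    by (rule subst_Pk_deg[OF d[of "Suc k"]])
       (use that i K in \<open>auto intro!: cyclic_zero_insertion_Pk_deg simp del: One_nat_def\<close>)
  ultimately show ?thesis
    unfolding stable_from_def by blast
qed

lemma swap_omega_inv:
  assumes "1 \<le> j" "Suc j < k"
  shows "swap (Suc j) (omega_inv k p) = omega_inv k (swap j p)"
  unfolding omega_inv_def swap_subst subst_swap
  by (rule subst_cong) (use assms in \<open>auto simp: swap_X swap_hom Transposition.transpose_def\<close>)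

text \<open>
  The defect of compatibility \<open>(1 - t) t\<^sup>k\<^sup>-\<^sup>i C\<^sub>k = t\<^sup>k\<^sup>-\<^sup>i C\<^sub>k - t\<^sup>k\<^sup>+\<^sup>1\<^sup>-\<^sup>i C\<^sub>k\<close> telescopes, so that subtracting
  \<open>t\<^sup>k\<^sup>-\<^sup>i C\<^sub>k\<close> removes it. For the symmetry, the cyclic shift raises by one the indices of the
  transpositions that fix \<open>U\<^sub>k\<^sub>-\<^sub>1 \<cdots> U\<^sub>i F\<^sub>k\<close>, which undoes the shift by one that these operators cause.
\<close>

lemma stable_from_main_part:
  assumes F: "stable_from K F" and i: "1 \<le> i" and K: "i < K"
  shows "stable_from K (\<lambda>k. omega_inv k (fold U [i..<k] (F k))
           - Const (t_var ^ (k - i)) * subst (cyclic_zero_insertion i k) (F (Suc k)))"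
    (is "stable_from K (\<lambda>k. ?A k - ?t k * ?C k)")
proof -
  have C: "stable_from K ?C"
    by (rule stable_from_cyclic_zero_insertion[OF assms])
  obtain d where d: "\<And>k. K \<le> k \<Longrightarrow> F k \<in> Pk_deg k d"
    using F by (auto simp: stable_from_def)
  obtain e where e: "\<And>k. K \<le> k \<Longrightarrow> ?C k \<in> Pk_deg k e"
    using C by (auto simp: stable_from_def)
  have "?A k - ?t k * ?C k \<in> Pk_deg k (max d e)" if k: "K \<le> k" for k
  proof -
    have "?A k \<in> Pk_deg k d"
      using d k i K by (intro omega_inv_Pk_deg fold_U_Pk_deg) auto
    then show ?thesis
      using e[OF k] by (intro Pk_deg_diff Pk_deg_Const_mult) (auto elim: Pk_deg_mono)
  qed
  moreover have "proj (Suc k) (?A (Suc k) - ?t (Suc k) * ?C (Suc k)) = ?A k - ?t k * ?C k"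
    if k: "K \<le> k" for k
  proof -
    have "F (Suc k) \<in> Pk_deg (Suc k) d" "proj (Suc k) (F (Suc k)) = F k"
      using F d k by (auto simp: stable_from_def)
    then have "proj (Suc k) (?A (Suc k)) = ?A k - Const ((1 - t_var) * t_var ^ (k - i)) * ?C k"
      using proj_omega_inv_fold_U[of "F (Suc k)" k d i] i K k by simp
    moreover have "proj (Suc k) (?C (Suc k)) = ?C k"
      using C k by (simp add: stable_from_def)
    ultimately have "proj (Suc k) (?A (Suc k) - ?t (Suc k) * ?C (Suc k)) =
        ?A k - Const ((1 - t_var) * t_var ^ (k - i)) * ?C k - ?t (Suc k) * ?C k"
      unfolding proj_def subst_hom subst_Const by simp
    then show ?thesis
      using K k by (simp add: Suc_diff_le Const_mult Const_diff algebra_simps)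
  qed
  moreover have "swap j (?A k - ?t k * ?C k) = ?A k - ?t k * ?C k" if j: "K \<le> j" "j < k" for j k
  proof -
    obtain l where l: "j = Suc l" "i \<le> l"
      using j K by (cases j) auto
    have "swap (Suc l) (F k) = F k"
      using F j l by (simp add: stable_from_def)
    then have "swap j (?A k) = ?A k"
      using l i j by (simp add: swap_omega_inv swap_fold_U)
    moreover have "swap j (?C k) = ?C k"
      using C j by (simp add: stable_from_def)
    ultimately show ?thesis by (simp add: swap_hom)
  qed
  ultimately show ?thesis
    unfolding stable_from_def by blast
qed


section \<open>Limits of sequences\<close>

lemma Pas_zero: "(\<lambda>k. 0) \<in> Pas"
  by (auto simp: Pas_def Psym_def Pinf_def Pk_def proj_def swap_inf_def trunc_def)

lemma Pas_imp_Pk: "F \<in> Pas \<Longrightarrow> F k \<in> Pk k"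
  by (auto simp: Pas_def Psym_def Pinf_def)

lemma coef_converges_eventually_0:
  assumes "\<And>k. K \<le> k \<Longrightarrow> a k = 0"
  shows "coef_converges a 0"
  unfolding coef_converges_def
  by (rule tendsto_eventually, rule eventually_sequentiallyI[of K]) (use assms in \<open>simp add: ord_t_def\<close>)

lemma ord_t_power: "ord_t (t_var ^ n) = ereal (real n)" "ord_t (- (t_var ^ n)) = ereal (real n)"
proof -
  have pow: "t_var ^ n = Fract ([:0, 1:] ^ n) 1"
    by (induction n) (simp_all add: t_var_def One_fract_def)
  have "order 0 ([:0, 1:] ^ n :: rat poly poly) = n"
    using order_power_n_n[of "0 :: rat poly" n] by simp
  then show "ord_t (t_var ^ n) = ereal (real n)" "ord_t (- (t_var ^ n)) = ereal (real n)"
    by (simp_all add: pow ord_t_Fract)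
qed

lemma coef_converges_power:
  shows "coef_converges (\<lambda>k. t_var ^ (k + 1 - i)) 0"
    and "coef_converges (\<lambda>k. - (t_var ^ (k + 1 - i))) 0"
proof -
  have "(\<lambda>k. ereal (real (k + 1 - i))) \<longlonglongrightarrow> \<infinity>"
    unfolding tendsto_PInfty_eq_at_top
    by (rule filterlim_compose[OF filterlim_real_sequentially],
        rule filterlim_at_top_mono[OF filterlim_minus_const_nat_at_top[of i]])
       (simp add: diff_le_mono)
  then show "coef_converges (\<lambda>k. t_var ^ (k + 1 - i)) 0"
    "coef_converges (\<lambda>k. - (t_var ^ (k + 1 - i))) 0"
    by (simp_all add: coef_converges_def ord_t_power)
qed

lemma has_lim_self:
  assumes "F \<in> Pas"
  shows "has_lim k0 F F"
  unfolding has_lim_def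
  by (rule exI[of _ 1], rule exI[of _ F], rule exI[of _ "\<lambda>_ _. 0"],
      rule exI[of _ "\<lambda>_ _. 0"], rule exI[of _ "\<lambda>_. 0"])
     (use assms Pas_zero coef_converges_eventually_0[of 0 "\<lambda>_. 0"] in
      \<open>auto simp: Pas_def Psym_def\<close>)

lemma has_lim_add_null_term:
  assumes "has_lim k0 f F" and G: "G \<in> Pas" and b: "coef_converges b 0"
    and f': "\<And>k. k0 \<le> k \<Longrightarrow> f' k = f k + Const (b k) * G k"
  shows "has_lim k0 f' F"
proof -
  obtain N h g a l where N: "N \<ge> (1::nat)" "h \<in> Pinf"
    and ga: "\<forall>i\<in>{1..N}. g i \<in> Pas \<and> coef_converges (a i) (l i)"
    and f: "\<forall>k\<ge>k0. f k = h k + (\<Sum>i=1..N. Const (a i k) * g i k)"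
    and F: "F = (\<lambda>k. h k + (\<Sum>i=1..N. Const (l i) * g i k))"
    using assms(1) unfolding has_lim_def by blast
  let ?g = "g(Suc N := G)" and ?a = "a(Suc N := b)" and ?l = "l(Suc N := 0)"
  have "\<forall>i\<in>{1..Suc N}. ?g i \<in> Pas \<and> coef_converges (?a i) (?l i)"
    using ga G b by (auto simp: le_Suc_eq)
  moreover have "\<forall>k\<ge>k0. f' k = h k + (\<Sum>i=1..Suc N. Const (?a i k) * ?g i k)"
    using f f' by (auto simp: add.assoc intro!: sum.cong)
  moreover have "F = (\<lambda>k. h k + (\<Sum>i=1..Suc N. Const (?l i) * ?g i k))"
    unfolding F by (auto intro!: sum.cong)
  ultimately show ?thesis
    unfolding has_lim_def using N
    by (intro exI[of _ "Suc N"] exI[of _ h] exI[of _ ?g] exI[of _ ?a] exI[of _ ?l]) simp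
qed

text \<open>
  A convergent sequence needs a decomposition of all its terms. The finitely many exceptional terms
  are corrected one at a time: the correction at index K is a component of some almost symmetric G, and
  G is added with the coefficient 1 at the index K and 0 elsewhere.
\<close>

lemma has_lim_cong_eventually:
  assumes "has_lim k0 f F" "\<And>k. k0 \<le> k \<Longrightarrow> f k \<in> Pk k" "\<And>k. k0 \<le> k \<Longrightarrow> f' k \<in> Pk k"
    and "\<And>k. K \<le> k \<Longrightarrow> k0 \<le> k \<Longrightarrow> f' k = f k"
  shows "has_lim k0 f' F"
  using assms
proof (induction K arbitrary: f)
  case 0
  have "coef_converges (\<lambda>_. 0) 0"
    by (rule coef_converges_eventually_0[of 0]) simp
  then show ?case
    by (rule has_lim_add_null_term[OF "0.prems"(1) Pas_zero]) (use "0.prems"(4) in simp)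
next
  case (Suc K)
  show ?case
  proof (cases "k0 \<le> K")
    case False
    then show ?thesis using Suc.IH[OF Suc.prems(1-3)] Suc.prems(4) by simp
  next
    case True
    obtain d where "f' K \<in> Pk_deg K d" "f K \<in> Pk_deg K d"
      using Suc.prems(2,3)[OF True] Pk_common_degree by metis
    then have "f' K - f K \<in> Pk K"
      by (intro Pk_deg_imp_Pk Pk_deg_diff)
    then obtain G where G: "G \<in> Pas" "G K = f' K - f K"
      by (rule Pas_with_component)
    have updated: "has_lim k0 (f(K := f' K)) F"
      by (rule has_lim_add_null_term[OF Suc.prems(1) G(1), of "\<lambda>k. if k = K then 1 else 0"])
         (use G(2) in \<open>auto intro: coef_converges_eventually_0[of "Suc K"]\<close>)
    show ?thesis
    proof (rule Suc.IH[OF updated])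
      show "(f(K := f' K)) k \<in> Pk k" if "k0 \<le> k" for k
        using Suc.prems(2,3)[OF that] by (cases "k = K") simp_all
      show "f' k = (f(K := f' K)) k" if "K \<le> k" "k0 \<le> k" for k
        using Suc.prems(4)[of k] that by (cases "k = K") auto
    qed (rule Suc.prems(3))
  qed
qed

lemma has_lim_add_null_term_eventually:
  assumes f: "has_lim k0 f F" and G: "G \<in> Pas" and a: "coef_converges a 0"
    and Pk: "\<And>k. k0 \<le> k \<Longrightarrow> f k \<in> Pk k" "\<And>k. k0 \<le> k \<Longrightarrow> f' k \<in> Pk k"
    and f': "\<And>k. K \<le> k \<Longrightarrow> f' k = f k + Const (a k) * G k"
  shows "has_lim k0 f' F"
proof (rule has_lim_cong_eventually)
  show "has_lim k0 (\<lambda>k. f k + Const (a k) * G k) F"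
    by (rule has_lim_add_null_term[OF f G a]) simp
  show "f k + Const (a k) * G k \<in> Pk k" if k: "k0 \<le> k" for k
  proof -
    obtain d where "f k \<in> Pk_deg k d" "G k \<in> Pk_deg k d"
      using Pk(1)[OF k] Pas_imp_Pk[OF G] Pk_common_degree by metis
    then have "f k + Const (a k) * G k \<in> Pk_deg k d"
      by (intro Pk_deg_add Pk_deg_Const_mult)
    then show ?thesis by (rule Pk_deg_imp_Pk)
  qed
qed (use Pk f' in auto)


section \<open>Limits of the Cherednik operators\<close>

lemma cherednik_eq:
  assumes "f \<in> Pk_deg k d" "1 \<le> i" "i \<le> k"
  shows "cherednik i k f =
      Const t_var * fold T [1..<i] (omega_inv k (fold U [i..<k] f))"
    and "deformed_cherednik i k f =
      Const t_var * fold T [1..<i] (pr1 (omega_inv k (fold U [i..<k] f)))"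
proof -
  have *: "t_var ^ (k + 1 - i) * (1 / t_var ^ (k - i)) = t_var"
    using assms by (simp add: Suc_diff_le)
  have om: "omega_inv k (Const c * p) = Const c * omega_inv k p" for c p
    by (simp add: omega_inv_def subst_hom)
  have pr: "pr1 (Const c * p) = Const c * pr1 p" for c p
    by (simp add: pr1_eq subst_hom right_diff_distrib)
  have fold: "fold (T_inv k) [i..<k] f = Const (1 / t_var ^ (k - i)) * fold U [i..<k] f"
    using assms by (intro fold_T_inv) auto
  show "cherednik i k f = Const t_var * fold T [1..<i] (omega_inv k (fold U [i..<k] f))"
    "deformed_cherednik i k f =
      Const t_var * fold T [1..<i] (pr1 (omega_inv k (fold U [i..<k] f)))"
    unfolding cherednik_def deformed_cherednik_def varpi_def fold om pr fold_T_Const_mult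
    by (simp_all only: * flip: mult.assoc Const_mult)
qed

lemma pr1_Pk_deg: "p \<in> Pk_deg k d \<Longrightarrow> pr1 p \<in> Pk_deg k d"
  unfolding pr1_eq
  by (intro Pk_deg_diff subst_Pk_deg[of p k d]) (auto intro!: Pk_deg_X)

lemma cherednik_Pk:
  assumes "f \<in> Pk k" "1 \<le> i" "i \<le> k"
  shows "cherednik i k f \<in> Pk k" "deformed_cherednik i k f \<in> Pk k"
proof -
  obtain d where d: "f \<in> Pk_deg k d"
    using assms(1) by (rule Pk_imp_Pk_deg)
  have "omega_inv k (fold U [i..<k] f) \<in> Pk_deg k d"
    using assms d by (intro omega_inv_Pk_deg fold_U_Pk_deg) auto
  then show "cherednik i k f \<in> Pk k" "deformed_cherednik i k f \<in> Pk k"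
    unfolding cherednik_eq[OF d assms(2,3)] using assms
    by (auto simp del: One_nat_def
        intro!: Pk_deg_imp_Pk[of _ k d] Pk_deg_Const_mult fold_T_Pk_deg pr1_Pk_deg)
qed

text \<open>
  The deformed operators enter only through their difference from the Cherednik operators. So a
  limit of either sequence is a limit of the other, without an appeal to uniqueness of limits.
\<close>

lemma cherednik_decomposition:
  assumes F: "F \<in> Pas" and i: "1 \<le> i"
  obtains K H C B where "i \<le> K" "H \<in> Pas" "C \<in> Pas" "B \<in> Pas"
    "\<And>k. K \<le> k \<Longrightarrow> cherednik i k (F k) = H k + Const (t_var ^ (k + 1 - i)) * C k"
    "\<And>k. K \<le> k \<Longrightarrow> cherednik i k (F k) =
        deformed_cherednik i k (F k) + Const (t_var ^ (k + 1 - i)) * B k"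
proof -
  obtain K0 where "stable_from K0 F"
    using F by (rule Pas_imp_stable_from)
  define K where "K = max K0 (Suc i)"
  have K: "stable_from K F" "i < K"
    using stable_from_mono[OF \<open>stable_from K0 F\<close>, of K] by (auto simp: K_def)
  define A where "A k = omega_inv k (fold U [i..<k] (F k))" for k
  define C where "C k = subst (cyclic_zero_insertion i k) (F (Suc k))" for k
  define B where "B k = subst (zero_insertion i) (F k)" for k
  define H where "H k = A k - Const (t_var ^ (k - i)) * C k" for k
  let ?T = "fold T [1..<i]"
  have "stable_from K H"
    unfolding H_def A_def C_def using K i by (intro stable_from_main_part)
  then have "stable_from K (\<lambda>k. Const t_var * ?T (H k))"
    using K by (intro stable_from_Const_mult stable_from_fold_T) auto
  then obtain H' where H': "H' \<in> Pas" "\<And>k. K \<le> k \<Longrightarrow> H' k = Const t_var * ?T (H k)"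
    using stable_from_extend by blast
  have "stable_from K (\<lambda>k. ?T (C k))"
    unfolding C_def using K i by (intro stable_from_fold_T stable_from_cyclic_zero_insertion) auto
  then obtain C' where C': "C' \<in> Pas" "\<And>k. K \<le> k \<Longrightarrow> C' k = ?T (C k)"
    using stable_from_extend by blast
  have "stable_from K (\<lambda>k. ?T (B k))"
    unfolding B_def using K i by (intro stable_from_fold_T stable_from_zero_insertion) auto
  then obtain B' where B': "B' \<in> Pas" "\<And>k. K \<le> k \<Longrightarrow> B' k = ?T (B k)"
    using stable_from_extend by blast
  have decomposition: "cherednik i k (F k) = H' k + Const (t_var ^ (k + 1 - i)) * C' k \<and>
    cherednik i k (F k) = deformed_cherednik i k (F k) + Const (t_var ^ (k + 1 - i)) * B' k"
    if k: "K \<le> k" for k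
  proof -
    have ik: "i \<le> k" using K k by simp
    obtain d where d: "F k \<in> Pk_deg k d"
      using K k by (auto simp: stable_from_def)
    have t: "Const (t_var ^ (k + 1 - i)) = Const t_var * Const (t_var ^ (k - i))"
      using ik by (simp add: Suc_diff_le flip: Const_mult)
    have cher: "cherednik i k (F k) = Const t_var * ?T (A k)"
      unfolding A_def using d i ik by (rule cherednik_eq)
    have deformed: "deformed_cherednik i k (F k) = Const t_var * ?T (pr1 (A k))"
      unfolding A_def using d i ik by (rule cherednik_eq)
    have "A k = H k + Const (t_var ^ (k - i)) * C k"
      by (simp add: H_def)
    moreover have "A k = pr1 (A k) + Const (t_var ^ (k - i)) * B k"
      unfolding A_def B_def pr1_omega_inv_fold_U[OF d i ik] by simp
    ultimately have TC: "?T (A k) = ?T (H k) + Const (t_var ^ (k - i)) * ?T (C k)"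
      and TB: "?T (A k) = ?T (pr1 (A k)) + Const (t_var ^ (k - i)) * ?T (B k)"
      by (metis fold_T_add fold_T_Const_mult)+
    have "cherednik i k (F k) = H' k + Const (t_var ^ (k + 1 - i)) * C' k"
      unfolding t cher TC H'(2)[OF k] C'(2)[OF k] by (simp only: distrib_left mult.assoc)
    moreover have "cherednik i k (F k) =
        deformed_cherednik i k (F k) + Const (t_var ^ (k + 1 - i)) * B' k"
      unfolding t deformed B'(2)[OF k] unfolding cher TB by (simp only: distrib_left mult.assoc)
    ultimately show ?thesis ..
  qed
  show ?thesis
  proof (rule that[OF _ H'(1) C'(1) B'(1)])
    show "i \<le> K" using K by simp
  qed (use decomposition in blast)+
qed

theorem theorem1:
  fixes i :: nat
  assumes "i \<ge> 1"
  shows "has_limit_operator i (cherednik i) \<and>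
         (\<forall>f\<in>Pas. limit_cherednik i f = limit_operator i (cherednik i) f)"
proof -
  have "(\<exists>H\<in>Pas. has_lim i (\<lambda>k. cherednik i k (F k)) H) \<and>
      (\<forall>G. has_lim i (\<lambda>k. deformed_cherednik i k (F k)) G \<longleftrightarrow> has_lim i (\<lambda>k. cherednik i k (F k)) G)"
    if F: "F \<in> Pas" for F
  proof -
    obtain K H C B where K: "i \<le> K" and HCB: "H \<in> Pas" "C \<in> Pas" "B \<in> Pas"
      and H: "\<And>k. K \<le> k \<Longrightarrow> cherednik i k (F k) = H k + Const (t_var ^ (k + 1 - i)) * C k"
      and B: "\<And>k. K \<le> k \<Longrightarrow> cherednik i k (F k) =
        deformed_cherednik i k (F k) + Const (t_var ^ (k + 1 - i)) * B k"
      using cherednik_decomposition[OF F assms] by blast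
    have Pk: "cherednik i k (F k) \<in> Pk k" "deformed_cherednik i k (F k) \<in> Pk k" if "i \<le> k" for k
      using cherednik_Pk[OF Pas_imp_Pk[OF F] assms that] by auto
    have "has_lim i (\<lambda>k. cherednik i k (F k)) H"
      by (rule has_lim_add_null_term_eventually[OF has_lim_self[OF HCB(1)] HCB(2) coef_converges_power(1)])
         (use H Pk Pas_imp_Pk[OF HCB(1)] in auto)
    moreover have "has_lim i (\<lambda>k. cherednik i k (F k)) G"
      if "has_lim i (\<lambda>k. deformed_cherednik i k (F k)) G" for G
      by (rule has_lim_add_null_term_eventually[OF that HCB(3) coef_converges_power(1)])
         (use B Pk in auto)
    moreover have "has_lim i (\<lambda>k. deformed_cherednik i k (F k)) G"
      if "has_lim i (\<lambda>k. cherednik i k (F k)) G" for G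
      by (rule has_lim_add_null_term_eventually[where K = K, OF that HCB(3) coef_converges_power(2)[of i]])
         (use B Pk in \<open>auto simp: Const_minus\<close>)
    ultimately show ?thesis using HCB(1) by blast
  qed
  then show ?thesis
    by (simp add: has_limit_operator_def limit_cherednik_def limit_operator_def the_lim_def)
qed

end
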